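(* Let $G\subset\mathrm{PSL}(3,\mathbb{C})$ be a discrete group without loxodromic elements. Then there exists a normal subgroup $G_0$ of $G$ with finite index such that $G_0$ leaves invariant a full flag in $\mathbb{P}^2_{\mathbb{C}}$. Hence the group $G_0$ is simultaneously triangularizable.
   Context: An element of $\mathrm{PSL}(3,\mathbb{C})$ is loxodromic if a lift to $\mathrm{SL}(3,\mathbb{C})$ has some eigenvalue of modulus different from $1$. A full flag in $\mathbb{P}^2_{\mathbb{C}}$ is a pair consisting of a point and a complex line containing it. *)

theory Defs
  imports "HOL-Analysis.Analysis" "HOL-Algebra.Coset"
begin

definition SL3 :: "(complex^3^3) monoid" where
  "SL3 = \<lparr>carrier = {A. det A = 1}, mult = (**), one = mat 1\<rparr>"

text \<open>The scalar matrices in SL(3,C), i.e. its centre.\<close>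

definition SL3_scalars :: "(complex^3^3) set" where
  "SL3_scalars = {mat c | c. c ^ 3 = 1}"

text \<open>An element of PSL(3,C) is a coset of the scalars, so its members are exactly its lifts
  to SL(3,C).\<close>

definition PSL3 :: "(complex^3^3) set monoid" where
  "PSL3 = SL3 Mod SL3_scalars"

lemma det_mat3: "det (mat c :: complex^3^3) = c ^ 3"
  by (simp add: det_3 mat_def power3_eq_cube)

lemma mat_mult_commute: "mat c ** (A :: complex^3^3) = A ** mat c"
  by (simp add: vec_eq_iff matrix_matrix_mult_def mat_def if_distrib if_distribR
      mult.commute cong: if_cong)

lemma mat_mult_vector: "(mat c :: complex^3^3) *v v = c *s v"
  by (simp add: vec_eq_iff matrix_vector_mult_def mat_def if_distrib if_distribR
      cong: if_cong)

lemma mat_mult_mat: "(mat c :: complex^3^3) ** mat d = mat (c * d)"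
  by (simp add: matrix_eq matrix_vector_mul_assoc[symmetric] mat_mult_vector)

lemma group_SL3: "group SL3"
proof (rule groupI)
  fix A assume "A \<in> carrier SL3"
  then have A: "det A = 1" by (simp add: SL3_def)
  then obtain B where B: "B ** A = mat 1"
    by (metis invertible_det_nz invertible_left_inverse zero_neq_one)
  then have "det B = 1"
    by (metis A det_I det_mul mult.right_neutral)
  with B show "\<exists>B\<in>carrier SL3. B \<otimes>\<^bsub>SL3\<^esub> A = \<one>\<^bsub>SL3\<^esub>"
    by (auto simp: SL3_def)
qed (auto simp: SL3_def det_mul matrix_mul_assoc)

lemma normal_SL3_scalars: "SL3_scalars \<lhd> SL3"
proof -
  interpret group SL3 by (rule group_SL3)
  have sub: "subgroup SL3_scalars SL3"
  proof (rule subgroupI)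
    show "SL3_scalars \<subseteq> carrier SL3"
      by (auto simp: SL3_scalars_def SL3_def det_mat3)
    show "SL3_scalars \<noteq> {}"
      unfolding SL3_scalars_def by (auto intro: exI[of _ 1])
  next
    fix A assume "A \<in> SL3_scalars"
    then obtain c where c: "A = mat c" "c ^ 3 = 1" by (auto simp: SL3_scalars_def)
    have "inv\<^bsub>SL3\<^esub> A = mat (inverse c)"
    proof (rule inv_equality)
      have "c \<noteq> 0" using c(2) by auto
      then show "mat (inverse c) \<otimes>\<^bsub>SL3\<^esub> A = \<one>\<^bsub>SL3\<^esub>"
        by (simp add: c SL3_def mat_mult_mat)
    qed (use c in \<open>auto simp: SL3_def det_mat3 power_inverse\<close>)
    then show "inv\<^bsub>SL3\<^esub> A \<in> SL3_scalars"
      using c by (auto simp: SL3_scalars_def power_inverse intro!: exI[of _ "inverse c"])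
  next
    fix A B assume "A \<in> SL3_scalars" "B \<in> SL3_scalars"
    then show "A \<otimes>\<^bsub>SL3\<^esub> B \<in> SL3_scalars"
      by (force simp: SL3_scalars_def SL3_def mat_mult_mat power_mult_distrib)
  qed
  show ?thesis
  proof (rule normalI[OF sub], safe)
    fix A B :: "complex^3^3"
    assume "A \<in> carrier SL3"
    show "B \<in> SL3_scalars #>\<^bsub>SL3\<^esub> A \<Longrightarrow> B \<in> A <#\<^bsub>SL3\<^esub> SL3_scalars"
      "B \<in> A <#\<^bsub>SL3\<^esub> SL3_scalars \<Longrightarrow> B \<in> SL3_scalars #>\<^bsub>SL3\<^esub> A"
      by (force simp: r_coset_def l_coset_def SL3_def SL3_scalars_def mat_mult_commute)+
  qed
qed

lemma group_PSL3: "group PSL3"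
  unfolding PSL3_def by (rule normal.factorgroup_is_group[OF normal_SL3_scalars])

lemma lift_unique_upto_scalar:
  assumes "g \<in> carrier PSL3" "A \<in> g" "B \<in> g"
  obtains c where "c ^ 3 = 1" "B = mat c ** A"
proof -
  obtain M where g: "g = {mat c ** M | c. c ^ 3 = 1}"
    using assms(1)
    by (auto simp: PSL3_def carrier_FactGroup r_coset_def SL3_scalars_def SL3_def)
  obtain a b where a: "a ^ 3 = 1" "A = mat a ** M" and b: "b ^ 3 = 1" "B = mat b ** M"
    using assms(2,3) unfolding g by blast
  have "a \<noteq> 0" using a(1) by auto
  show ?thesis
  proof
    show "(b / a) ^ 3 = 1" using a b by (simp add: power_divide)
    show "B = mat (b / a) ** A"
      using \<open>a \<noteq> 0\<close> by (simp add: a b matrix_mul_assoc mat_mult_mat)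
  qed
qed

text \<open>SL(3,C) carries the subspace topology of the space of matrices, and PSL(3,C) the
  quotient topology; the preimage of a set \<open>U\<close> of cosets under the projection is \<open>\<Union>U\<close>.\<close>

definition SL3_topology :: "(complex^3^3) topology" where
  "SL3_topology = top_of_set (carrier SL3)"

definition PSL3_topology :: "(complex^3^3) set topology" where
  "PSL3_topology = topology (\<lambda>U. U \<subseteq> carrier PSL3 \<and> openin SL3_topology (\<Union>U))"

definition discrete_in_PSL3 :: "(complex^3^3) set set \<Rightarrow> bool" where
  "discrete_in_PSL3 G \<longleftrightarrow> subtopology PSL3_topology G = discrete_topology G"

lemma PSL3_disjoint:
  "\<lbrakk>g \<in> carrier PSL3; h \<in> carrier PSL3; A \<in> g; A \<in> h\<rbrakk> \<Longrightarrow> g = h"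
  using group.rcos_disjoint[OF group_SL3 normal_imp_subgroup[OF normal_SL3_scalars]]
  by (auto simp: PSL3_def FactGroup_def pairwise_def disjnt_def)

lemma openin_PSL3_topology:
  "openin PSL3_topology U \<longleftrightarrow> U \<subseteq> carrier PSL3 \<and> openin SL3_topology (\<Union>U)"
proof -
  have "istopology (\<lambda>U. U \<subseteq> carrier PSL3 \<and> openin SL3_topology (\<Union>U))"
    unfolding istopology_def
  proof (intro conjI allI impI; (elim conjE)?)
    fix S T assume *: "S \<subseteq> carrier PSL3" "openin SL3_topology (\<Union>S)"
      "T \<subseteq> carrier PSL3" "openin SL3_topology (\<Union>T)"
    then have "\<Union>(S \<inter> T) = \<Union>S \<inter> \<Union>T"
      using PSL3_disjoint by blast
    then show "openin SL3_topology (\<Union>(S \<inter> T))"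
      using * by auto
    show "S \<inter> T \<subseteq> carrier PSL3" using * by auto
  next
    fix K assume *: "\<forall>S\<in>K. S \<subseteq> carrier PSL3 \<and> openin SL3_topology (\<Union>S)"
    have "openin SL3_topology (\<Union>(Union ` K))"
      using * by (intro openin_Union) blast
    moreover have "\<Union>(\<Union>K) = \<Union>(Union ` K)" by blast
    ultimately show "openin SL3_topology (\<Union>(\<Union>K))" by simp
    show "\<Union>K \<subseteq> carrier PSL3" using * by auto
  qed
  then show ?thesis
    by (simp add: PSL3_topology_def topology_inverse')
qed

lemma quotient_map_PSL3:
  "quotient_map SL3_topology PSL3_topology (\<lambda>A. SL3_scalars #>\<^bsub>SL3\<^esub> A)"
proof -
  interpret group SL3 by (rule group_SL3)
  have sg: "subgroup SL3_scalars SL3"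
    by (rule normal_imp_subgroup[OF normal_SL3_scalars])
  have ts: "topspace SL3_topology = carrier SL3"
    by (simp add: SL3_topology_def)
  have un: "\<Union>(carrier PSL3) = carrier SL3"
    unfolding PSL3_def FactGroup_def using rcosets_part_G[OF sg] by simp
  have tp: "topspace PSL3_topology = carrier PSL3"
  proof -
    have "openin PSL3_topology (carrier PSL3)"
      unfolding openin_PSL3_topology un by (metis ts openin_topspace subset_refl)
    then show ?thesis
      by (metis openin_PSL3_topology openin_subset openin_topspace subset_antisym)
  qed
  have self: "A \<in> SL3_scalars #>\<^bsub>SL3\<^esub> A" if "A \<in> carrier SL3" for A
    using rcos_self[OF that sg] .
  have mem: "SL3_scalars #>\<^bsub>SL3\<^esub> A \<in> carrier PSL3" if "A \<in> carrier SL3" for A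
    using that by (auto simp: PSL3_def carrier_FactGroup)
  have eq: "{A \<in> carrier SL3. SL3_scalars #>\<^bsub>SL3\<^esub> A \<in> U} = \<Union>U" if U: "U \<subseteq> carrier PSL3" for U
  proof safe
    fix A assume "A \<in> carrier SL3" "SL3_scalars #>\<^bsub>SL3\<^esub> A \<in> U"
    then show "A \<in> \<Union>U" using self by blast
  next
    fix A g assume "A \<in> g" "g \<in> U"
    then show "A \<in> carrier SL3" using U un by blast
    then have "SL3_scalars #>\<^bsub>SL3\<^esub> A = g"
      using PSL3_disjoint[OF mem _ self] \<open>A \<in> g\<close> \<open>g \<in> U\<close> U by blast
    then show "SL3_scalars #>\<^bsub>SL3\<^esub> A \<in> U" using \<open>g \<in> U\<close> by simp
  qed
  show ?thesis
    unfolding quotient_map_def ts tp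
    by (auto simp: eq openin_PSL3_topology PSL3_def carrier_FactGroup)
qed

definition matrix_eigenvalue :: "complex^3^3 \<Rightarrow> complex \<Rightarrow> bool" where
  "matrix_eigenvalue A c \<longleftrightarrow> (\<exists>v. v \<noteq> 0 \<and> A *v v = c *s v)"

definition loxodromic :: "(complex^3^3) set \<Rightarrow> bool" where
  "loxodromic g \<longleftrightarrow> (\<exists>A\<in>g. \<exists>c. matrix_eigenvalue A c \<and> cmod c \<noteq> 1)"

text \<open>A point is a one-dimensional complex subspace of \<open>C\<^sup>3\<close>; a complex line is the set of points
  contained in a two-dimensional complex subspace. (\<open>vec.subspace\<close> and \<open>vec.dim\<close> refer
  to the complex scalar multiplication, unlike \<open>subspace\<close> and \<open>dim\<close>.)\<close>

type_synonym point = "(complex^3) set"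

definition P2 :: "point set" where
  "P2 = {p. vec.subspace p \<and> vec.dim p = 1}"

definition complex_lines :: "point set set" where
  "complex_lines = {{p \<in> P2. p \<subseteq> W} | W. vec.subspace W \<and> vec.dim W = 2}"

definition full_flags :: "(point \<times> point set) set" where
  "full_flags = {(p, l). p \<in> P2 \<and> l \<in> complex_lines \<and> p \<in> l}"

text \<open>All lifts of \<open>g\<close> map \<open>p\<close> to the same point, so the set below is a singleton; see
  \<open>PSL3_act_lift\<close>.\<close>

definition PSL3_act :: "(complex^3^3) set \<Rightarrow> point \<Rightarrow> point" where
  "PSL3_act g p = the_elem ((\<lambda>A. (*v) A ` p) ` g)"

lemma PSL3_act_lift:
  assumes g: "g \<in> carrier PSL3" and A: "A \<in> g" and p: "p \<in> P2"
  shows "PSL3_act g p = (*v) A ` p"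
proof -
  have eq: "(*v) B ` p = (*v) A ` p" if B: "B \<in> g" for B
  proof -
    have "(*v) B ` p \<subseteq> (*v) A ` p" if "A \<in> g" "B \<in> g" for A B
    proof -
      obtain c where c: "B = mat c ** A"
        using lift_unique_upto_scalar[OF g \<open>A \<in> g\<close> \<open>B \<in> g\<close>] by blast
      have "B *v v = A *v (c *s v)" for v
        by (simp only: c mat_mult_commute matrix_vector_mul_assoc[symmetric] mat_mult_vector)
      moreover have "c *s v \<in> p" if "v \<in> p" for v
        using p that by (auto simp: P2_def vec.subspace_def)
      ultimately show ?thesis by auto
    qed
    with A B show ?thesis by blast
  qed
  have "g \<noteq> {}" using A by blast
  then show ?thesis
    unfolding PSL3_act_def using eq by (rule the_elem_image_unique)
qed

definition leaves_flag_invariant :: "(complex^3^3) set set \<Rightarrow> point \<times> point set \<Rightarrow> bool" where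
  "leaves_flag_invariant H F \<longleftrightarrow>
     (\<forall>g\<in>H. PSL3_act g (fst F) = fst F \<and> PSL3_act g ` snd F = snd F)"

text \<open>The index type \<open>3\<close> has elements \<open>1, 2, 3\<close> with \<open>3 = 0\<close>, ordered as \<open>0 < 1 < 2\<close>. Since the
  orderings of a basis are related by permutation matrices, this choice is immaterial below.\<close>

definition upper_triangular_mat :: "complex^3^3 \<Rightarrow> bool" where
  "upper_triangular_mat A \<longleftrightarrow> (\<forall>i j. j < i \<longrightarrow> A $ i $ j = 0)"

definition simultaneously_triangularizable :: "(complex^3^3) set set \<Rightarrow> bool" where
  "simultaneously_triangularizable H \<longleftrightarrow>
     (\<exists>P. invertible P \<and> (\<forall>g\<in>H. \<forall>A\<in>g. upper_triangular_mat (matrix_inv P ** A ** P)))"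

end

theory Submission
  imports Defs "HOL-Computational_Algebra.Fundamental_Theorem_Algebra"
begin

text \<open>Let \<open>\<Gamma>\<close> be the group of all lifts of elements of \<open>G\<close>. All eigenvalues of its members have modulus 1, so their
traces are bounded by 3. A full flag is encoded by a column vector \<open>v\<close> (the point) and a row vector
\<open>f\<close> with \<open>pairing f v = 0\<close> (the line is the kernel of \<open>f\<close>); it is fixed by \<open>A\<close> iff \<open>v\<close> is a right and \<open>f\<close>
a left eigenvector of \<open>A\<close>. This description is self-dual under transposition. Three cases arise.

If \<open>\<Gamma>\<close> has neither a common right nor a common left eigenvector, it acts irreducibly. An irreducible
group with bounded traces is bounded (\<open>bounded_if_irreducible_bounded_trace\<close>), and a discrete bounded
group is finite modulo scalars (\<open>irreducible_case\<close>).

If \<open>\<Gamma>\<close> has a common right eigenvector \<open>v\<close>, either it fixes a flag through \<open>v\<close>, or its image in the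
\<open>2 \<times> 2\<close> matrices acting on the quotient by \<open>v\<close> is irreducible and hence bounded. Rescaled so as to fix
\<open>v\<close>, the group then resembles a discrete group of Euclidean motions whose rotations are the
\<open>2 \<times> 2\<close> blocks \<open>\<rho> A\<close>, and Bieberbach's argument applies. If \<open>\<rho> A\<close> and \<open>\<rho> B\<close> are close to 1, the iterated
commutators \<open>[A, [A, \<dots> [A, B]]]\<close> tend to 1, so by discreteness they are eventually equal to 1
(\<open>iterated_commutator_trivial\<close>). Going back down through the commutators, a \<open>2 \<times> 2\<close> form of
Frobenius' lemma (\<open>commutes_if_commutes_with_conjugate_2\<close>) shows that \<open>\<rho> A\<close> and \<open>\<rho> B\<close> commute. Hence the
blocks close to 1 have a common left eigenvector, which completes \<open>v\<close> to a flag; since the blocks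
form a bounded set, finitely many translates of a neighbourhood of 1 cover the group.

If \<open>\<Gamma>\<close> has a common left eigenvector, the transposed group falls under the second case.

In every case finitely many right translates of the set of those \<open>A\<close> all of whose \<open>\<Gamma>\<close>-conjugates fix the
flag cover \<open>\<Gamma>\<close> (\<open>virtual_flag\<close>). The subgroup \<open>G\<^sub>0\<close> is the normal core in \<open>G\<close> of the stabiliser of the flag.\<close>

section \<open>Row vectors, norms and spans of matrices\<close>

definition pairing :: "'a::comm_semiring_1^'n \<Rightarrow> 'a^'n \<Rightarrow> 'a" where
  "pairing f x = (\<Sum>i\<in>UNIV. f $ i * x $ i)"

lemma pairing_commute: "pairing f x = pairing x f"
  by (simp add: pairing_def mult.commute)

lemma pairing_add_right: "pairing f (x + y) = pairing f x + pairing f y"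
  by (simp add: pairing_def algebra_simps sum.distrib)

lemma pairing_scale_right: "pairing f (c *s x) = c * pairing f x"
  by (simp add: pairing_def sum_distrib_left algebra_simps)

lemma pairing_scale_left: "pairing (c *s f) x = c * pairing f x"
  by (simp add: pairing_def sum_distrib_left algebra_simps)

lemma pairing_zero_right [simp]: "pairing f 0 = 0"
  by (simp add: pairing_def)

lemma pairing_zero_left [simp]: "pairing 0 x = 0"
  by (simp add: pairing_def)

lemma pairing_vector_matrix: "pairing (f v* A) x = pairing f (A *v x)"
  unfolding pairing_def vector_matrix_mult_def matrix_vector_mult_def
  by (simp add: sum_distrib_left sum_distrib_right mult.assoc) (rule sum.swap)

lemma pairing_axis: "pairing f (axis i 1) = f $ i"
  by (simp add: pairing_def axis_def if_distrib cong: if_cong)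

lemma pairing_nondegenerate:
  assumes "f \<noteq> 0"
  shows "\<exists>x. pairing f x = (1 :: 'a::field)"
proof -
  obtain i where "f $ i \<noteq> 0" using assms by (auto simp: vec_eq_iff)
  then have "pairing f (inverse (f $ i) *s axis i 1) = 1"
    by (simp add: pairing_scale_right pairing_axis)
  then show ?thesis by blast
qed

text \<open>Extend a basis of the subspace by one vector outside of it; a linear map that kills the basis but
not the new vector has a matrix with a suitable row.\<close>

lemma annihilator_of_proper_subspace:
  fixes S :: "('a::field^'n) set"
  assumes "vec.subspace S" "S \<noteq> UNIV"
  shows "\<exists>f. f \<noteq> 0 \<and> (\<forall>s\<in>S. pairing f s = 0)"
proof -
  obtain x where x: "x \<notin> S" using assms(2) by auto
  obtain B where B: "B \<subseteq> S" "vec.independent B" "S \<subseteq> vec.span B"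
    using vec.basis_exists[of S] by metis
  have span: "vec.span B = S" using B assms(1) by (metis subset_antisym vec.span_minimal)
  have "vec.independent (insert x B)"
    using B(2) x span by (simp add: vec.independent_insertI)
  then obtain g :: "'a^'n \<Rightarrow> 'a^'n" where g: "Vector_Spaces.linear (*s) (*s) g"
      "\<forall>b\<in>insert x B. g b = (if b = x then x else 0)"
    using vec.linear_independent_extend[where f = "\<lambda>b. if b = x then x else 0"] by blast
  have gB: "g s = 0" if "s \<in> S" for s
  proof -
    have "g b = 0" if "b \<in> B" for b using g(2) that x B(1) by auto
    then show ?thesis
      using vec.linear_eq_0_on_span[OF g(1), of B s] that span by auto
  qed
  have "x \<noteq> 0" using x assms(1) vec.subspace_0 by blast
  then obtain k where k: "x $ k \<noteq> 0" by (auto simp: vec_eq_iff)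
  define f where "f = matrix g $ k"
  have f: "pairing f y = g y $ k" for y
    using matrix_works[OF g(1), of y]
    by (simp add: f_def pairing_def matrix_vector_mult_def vec_eq_iff)
  have "f \<noteq> 0" using f[of x] g(2) k by auto
  moreover have "\<forall>s\<in>S. pairing f s = 0" using f gB by simp
  ultimately show ?thesis by blast
qed

lemma norm_scalar_mult: "norm (c *s (x :: complex^'n)) = cmod c * norm x"
  by (simp add: norm_vec_def norm_mult L2_set_right_distrib)

lemma norm_matrix_mult_le:
  fixes A :: "complex^'n^'m" and B :: "complex^'p^'n"
  shows "norm (A ** B) \<le> norm A * norm B"
proof -
  have row: "norm ((A ** B) $ i) \<le> norm (A $ i) * norm B" for i
  proof -
    have "(A ** B) $ i = (\<Sum>j\<in>UNIV. A $ i $ j *s B $ j)"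
      by (simp add: vec_eq_iff matrix_matrix_mult_def)
    also have "norm \<dots> \<le> (\<Sum>j\<in>UNIV. norm (A $ i $ j *s B $ j))"
      by (rule norm_sum)
    also have "\<dots> = (\<Sum>j\<in>UNIV. \<bar>cmod (A $ i $ j)\<bar> * \<bar>norm (B $ j)\<bar>)"
      by (simp add: norm_scalar_mult)
    also have "\<dots> \<le> norm (A $ i) * norm B"
      unfolding norm_vec_def[of "A $ i"] norm_vec_def[of B] by (rule L2_set_mult_ineq)
    finally show ?thesis .
  qed
  have "norm (A ** B) \<le> L2_set (\<lambda>i. norm (A $ i) * norm B) UNIV"
    unfolding norm_vec_def[of "A ** B"] by (rule L2_set_mono) (use row in auto)
  also have "\<dots> = norm A * norm B"
    by (simp add: L2_set_left_distrib norm_vec_def[of A])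
  finally show ?thesis .
qed

lemma matrix_add_rdistrib: "((A :: 'a::semiring_1^'n^'m) + B) ** C = A ** C + B ** C"
  by (simp add: vec_eq_iff matrix_matrix_mult_def algebra_simps sum.distrib)

lemma bounded_bilinear_matrix_mult:
  "bounded_bilinear ((**) :: complex^'n^'m \<Rightarrow> complex^'p^'n \<Rightarrow> complex^'p^'m)"
proof
  show "\<exists>K. \<forall>a b. norm ((a :: complex^'n^'m) ** (b :: complex^'p^'n)) \<le> norm a * norm b * K"
    by (intro exI[of _ 1]) (simp add: norm_matrix_mult_le)
qed (simp_all add: matrix_add_ldistrib matrix_add_rdistrib scalar_matrix_assoc matrix_scalar_ac)

lemma bounded_linear_trace: "bounded_linear (trace :: complex^'n^'n \<Rightarrow> complex)"
proof -
  have "linear (trace :: complex^'n^'n \<Rightarrow> complex)"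
    by (rule linearI) (simp_all add: trace_def sum.distrib scaleR_sum_right)
  then show ?thesis by (simp add: linear_conv_bounded_linear)
qed

lemma scalar_matrix_vector_mult: "(mat c :: 'a::semiring_1^'n^'n) *v x = c *s x"
  by (simp add: vec_eq_iff matrix_vector_mult_def mat_def if_distrib if_distribR cong: if_cong)

lemma mat_matrix_mult_nth: "((mat c :: 'a::semiring_1^'n^'n) ** A) $ i $ j = c * A $ i $ j"
  by (simp add: matrix_matrix_mult_def mat_def if_distrib if_distribR cong: if_cong)

lemma matrix_mult_mat_nth: "((A :: 'a::comm_semiring_1^'n^'n) ** mat c) $ i $ j = c * A $ i $ j"
  by (simp add: matrix_matrix_mult_def mat_def if_distrib if_distribR mult.commute cong: if_cong)

lemma trace_mat_mult: "trace ((mat c :: 'a::semiring_1^'n^'n) ** A) = c * trace A"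
  by (simp add: trace_def mat_matrix_mult_nth sum_distrib_left)

text \<open>Closing under \<open>mat c ** _\<close> makes this the span over the field of the entries, not over the reals.\<close>

inductive_set mspan :: "('a::comm_ring_1^'n^'n) set \<Rightarrow> ('a^'n^'n) set" for S where
  mspan_base: "A \<in> S \<Longrightarrow> A \<in> mspan S"
| mspan_zero: "0 \<in> mspan S"
| mspan_add: "A \<in> mspan S \<Longrightarrow> B \<in> mspan S \<Longrightarrow> A + B \<in> mspan S"
| mspan_scale: "A \<in> mspan S \<Longrightarrow> mat c ** A \<in> mspan S"

lemma mspan_mult:
  assumes S: "\<And>A B. A \<in> S \<Longrightarrow> B \<in> S \<Longrightarrow> A ** B \<in> S"
    and A: "A \<in> mspan S" and B: "B \<in> mspan S"
  shows "A ** B \<in> mspan S"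
proof -
  have right: "A ** B \<in> mspan S" if "A \<in> S" for A
    using B
  proof induction
    case (mspan_scale C c)
    have "A ** (mat c ** C) = mat c ** (A ** C)"
    proof -
      have "A ** mat c = mat c ** A" 
        by (simp add: vec_eq_iff matrix_mult_mat_nth mat_matrix_mult_nth)
      then show ?thesis by (metis matrix_mul_assoc)
    qed
    then show ?case using mspan_scale.IH by (simp add: mspan.mspan_scale)
  qed (use that S in \<open>auto simp: matrix_add_ldistrib intro: mspan.intros\<close>)
  show ?thesis
    using A
    by induction (auto simp: right matrix_add_rdistrib matrix_mul_assoc[symmetric] intro: mspan.intros)
qed

text \<open>How irreducibility enters. The vectors that the span moves \<open>y\<close> to form a subspace; if it is proper, some row vector kills it.\<close>

lemma orbit_annihilator:
  fixes S :: "('a::field^'n^'n) set"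
  assumes "\<nexists>X. X \<in> mspan S \<and> X *v y = x"
  shows "\<exists>f. f \<noteq> 0 \<and> (\<forall>A\<in>S. pairing f (A *v y) = 0)"
proof -
  let ?Y = "(\<lambda>X. X *v y) ` mspan S"
  have "vec.subspace ?Y"
  proof (rule vec.subspaceI)
    show "0 \<in> ?Y" using mspan_zero by (rule rev_image_eqI) simp
    show "u + w \<in> ?Y" if "u \<in> ?Y" "w \<in> ?Y" for u w
    proof -
      obtain A B where AB: "A \<in> mspan S" "B \<in> mspan S" "u = A *v y" "w = B *v y"
        using \<open>u \<in> ?Y\<close> \<open>w \<in> ?Y\<close> by blast
      show ?thesis
        by (rule rev_image_eqI[OF mspan_add[OF AB(1,2)]])
          (simp add: AB matrix_vector_mult_add_rdistrib)
    qed
    show "c *s u \<in> ?Y" if u: "u \<in> ?Y" for c u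
    proof -
      obtain A where A: "A \<in> mspan S" "u = A *v y" using u by blast
      show ?thesis
        by (rule rev_image_eqI[OF mspan_scale[OF A(1), of c]])
          (simp add: A matrix_vector_mul_assoc[symmetric] scalar_matrix_vector_mult)
    qed
  qed
  moreover have "?Y \<noteq> UNIV" using assms by (metis UNIV_I imageE)
  ultimately obtain f where "f \<noteq> 0" "\<forall>s\<in>?Y. pairing f s = 0"
    using annihilator_of_proper_subspace by blast
  then show ?thesis by (blast intro: mspan_base)
qed

section \<open>Irreducible groups with bounded traces are bounded\<close>

lemma singular_iff_kernel:
  fixes A :: "'a::field^'n^'n"
  shows "det A = 0 \<longleftrightarrow> (\<exists>x. x \<noteq> 0 \<and> A *v x = 0)"
  by (metis invertible_det_nz invertible_left_inverse matrix_left_invertible_ker)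

text \<open>These are Newton's identities: they express the characteristic polynomial at 1 by traces of powers,
so that vanishing traces force it to be 1.\<close>

lemma det_one_minus_2:
  fixes M :: "complex^2^2"
  shows "2 * det (mat 1 - M) = 2 - 2 * trace M + (trace M)\<^sup>2 - trace (M ** M)"
  by (simp add: det_2 trace_def sum_2 matrix_matrix_mult_def mat_def power2_eq_square) algebra

lemma det_one_minus_3:
  fixes M :: "complex^3^3"
  shows "6 * det (mat 1 - M) = 6 - 6 * trace M + 3 * ((trace M)\<^sup>2 - trace (M ** M))
    - ((trace M) ^ 3 - 3 * trace M * trace (M ** M) + 2 * trace (M ** M ** M))"
  by (simp add: det_3 trace_def sum_3 matrix_matrix_mult_def mat_def power2_eq_square
      power3_eq_cube) algebra

lemma no_fixed_vector_if_det:
  fixes M :: "'a::field^'n^'n"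
  assumes "det (mat 1 - M) \<noteq> 0" "M *v x = x"
  shows "x = 0"
  using assms singular_iff_kernel[of "mat 1 - M"]
  by (auto simp: matrix_vector_mult_diff_rdistrib)

lemma traceless_powers_no_fixed_vector_2:
  fixes M :: "complex^2^2"
  assumes "trace M = 0" "trace (M ** M) = 0" "M *v x = x"
  shows "x = 0"
  using det_one_minus_2[of M] assms by (intro no_fixed_vector_if_det[of M]) auto

lemma traceless_powers_no_fixed_vector_3:
  fixes M :: "complex^3^3"
  assumes "trace M = 0" "trace (M ** M) = 0" "trace (M ** M ** M) = 0" "M *v x = x"
  shows "x = 0"
  using det_one_minus_3[of M] assms by (intro no_fixed_vector_if_det[of M]) auto

lemma char_poly_3:
  fixes A :: "complex^3^3"
  shows "det (mat x - A) = x ^ 3 - trace A * x\<^sup>2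
    + (A$1$1 * A$2$2 - A$1$2 * A$2$1 + A$1$1 * A$3$3 - A$1$3 * A$3$1 + A$2$2 * A$3$3 - A$2$3 * A$3$2) * x
    - det A"
  by (simp add: det_3 trace_def sum_3 mat_def power2_eq_square power3_eq_cube) algebra

text \<open>The trace is the sum of the three roots of the characteristic polynomial.\<close>

lemma cmod_trace_le_3:
  fixes A :: "complex^3^3"
  assumes ev: "\<And>c. matrix_eigenvalue A c \<Longrightarrow> cmod c = 1"
  shows "cmod (trace A) \<le> 3"
proof -
  obtain e where e: "\<And>x. det (mat x - A) = x ^ 3 - trace A * x\<^sup>2 + e * x - det A"
    using char_poly_3 by blast
  define p where "p = [:- det A, e, - trace A, 1:]"
  have p: "poly p x = det (mat x - A)" for x
    by (simp add: p_def e power2_eq_square power3_eq_cube algebra_simps)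
  have "p \<noteq> 0" "degree p = 3" "lead_coeff p = 1" by (simp_all add: p_def)
  then obtain R where R: "size R = 3" "p = (\<Prod>a\<in>#R. [:- a, 1:])"
    using alg_closed_imp_factorization[of p] by auto
  obtain a R1 where R1: "R = add_mset a R1" "size R1 = 2"
    using R(1) size_eq_Suc_imp_eq_union[of R 2] by auto
  obtain b R2 where R2: "R1 = add_mset b R2" "size R2 = 1"
    using R1(2) size_eq_Suc_imp_eq_union[of R1 1] by auto
  obtain c where "R2 = {#c#}"
    using R2(2) size_1_singleton_mset by blast
  then have abc: "R = {#a, b, c#}" using R1 R2 by simp
  have pabc: "p = [:- a, 1:] * ([:- b, 1:] * [:- c, 1:])" by (simp add: R(2) abc)
  have t: "trace A = a + b + c"
    using arg_cong[OF pabc, of "\<lambda>q. coeff q 2"] by (simp add: p_def eval_nat_numeral algebra_simps)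
  have unit: "cmod z = 1" if "poly p z = 0" for z
  proof -
    from that obtain x where x: "x \<noteq> 0" "(mat z - A) *v x = 0"
      using p singular_iff_kernel by metis
    then have "A *v x = z *s x"
      by (simp add: matrix_vector_mult_diff_rdistrib scalar_matrix_vector_mult)
    then show ?thesis using x(1) ev unfolding matrix_eigenvalue_def by blast
  qed
  have "cmod a = 1" "cmod b = 1" "cmod c = 1"
    by (rule unit; simp only: pabc poly_mult; simp)+
  then show ?thesis
    unfolding t using norm_triangle_ineq[of "a + b" c] norm_triangle_ineq[of a b] by linarith
qed

lemma closure_mspan_mult:
  fixes S :: "(complex^'n^'n) set"
  assumes S: "\<And>A B. A \<in> S \<Longrightarrow> B \<in> S \<Longrightarrow> A ** B \<in> S"
    and "A \<in> closure (mspan S)" "B \<in> closure (mspan S)"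
  shows "A ** B \<in> closure (mspan S)"
proof -
  obtain a where a: "\<forall>n. a n \<in> mspan S" "a \<longlonglongrightarrow> A"
    using iffD1[OF closure_sequential assms(2)] by blast
  obtain b where b: "\<forall>n. b n \<in> mspan S" "b \<longlonglongrightarrow> B"
    using iffD1[OF closure_sequential assms(3)] by blast
  have "(\<lambda>n. a n ** b n) \<longlonglongrightarrow> A ** B"
    by (rule bounded_bilinear.tendsto[OF bounded_bilinear_matrix_mult a(2) b(2)])
  moreover have "a n ** b n \<in> mspan S" for n
    using mspan_mult[OF S] a(1) b(1) by blast
  ultimately show ?thesis by (intro iffD2[OF closure_sequential] exI[of _ "\<lambda>n. a n ** b n"]) blast
qed

text \<open>If the matrices were unbounded, normalising them would give in the limit some \<open>T \<noteq> 0\<close> in the closed algebra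
that they span, with \<open>trace (T ** X) = 0\<close> for all \<open>X\<close> in that algebra. By irreducibility some \<open>X\<close> maps a nonzero
vector \<open>T *v y\<close> back to \<open>y\<close>, so \<open>T ** X\<close> fixes \<open>T *v y\<close>; but all powers of \<open>T ** X\<close> have trace 0. The
assumption \<open>newton\<close> says that this is impossible; it holds in dimensions 2 and 3 by
\<open>traceless_powers_no_fixed_vector_2\<close> and \<open>traceless_powers_no_fixed_vector_3\<close>.\<close>

lemma bounded_if_irreducible_bounded_trace:
  fixes S :: "(complex^'n^'n) set"
  assumes mult: "\<And>A B. A \<in> S \<Longrightarrow> B \<in> S \<Longrightarrow> A ** B \<in> S"
    and tr: "\<And>A. A \<in> S \<Longrightarrow> cmod (trace A) \<le> K"
    and trans: "\<And>x y. y \<noteq> 0 \<Longrightarrow> \<exists>X. X \<in> mspan S \<and> X *v y = x"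
    and newton: "\<And>(M :: complex^'n^'n) x. trace M = 0 \<Longrightarrow> trace (M ** M) = 0
      \<Longrightarrow> trace (M ** M ** M) = 0 \<Longrightarrow> M *v x = x \<Longrightarrow> x = 0"
  shows "bounded S"
proof (rule ccontr)
  assume "\<not> bounded S"
  then have "\<exists>A\<in>S. norm A > real n" for n
    unfolding bounded_iff by (metis not_le)
  then obtain a where a: "\<And>n. a n \<in> S" "\<And>n. norm (a n) > real n" by metis
  define c where "c n = (1 / norm (a n)) *\<^sub>R a n" for n
  have pos: "norm (a n) > 0" for n using a(2)[of n] by (smt (verit) of_nat_0_le_iff)
  have "c n \<in> sphere 0 1" for n using pos[of n] by (simp add: c_def)
  then obtain T r where T: "T \<in> sphere 0 1" "strict_mono r" "(c \<circ> r) \<longlonglongrightarrow> T"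
    using compact_sphere[of "0::complex^'n^'n" 1] unfolding compact_def by metis
  have inv0: "(\<lambda>n. 1 / norm (a (r n))) \<longlonglongrightarrow> 0"
  proof (rule real_tendsto_sandwich[where f = "\<lambda>_. 0" and h = "\<lambda>n. 1 / real n"])
    show "\<forall>\<^sub>F n in sequentially. 1 / norm (a (r n)) \<le> 1 / real n"
    proof (rule eventually_sequentiallyI[of 1])
      fix n :: nat assume "1 \<le> n"
      have "real n \<le> real (r n)" using seq_suble[OF T(2)] by simp
      then show "1 / norm (a (r n)) \<le> 1 / real n"
        using a(2)[of "r n"] \<open>1 \<le> n\<close> by (intro divide_left_mono) (auto intro: mult_pos_pos pos)
    qed
    show "(\<lambda>n. 1 / real n) \<longlonglongrightarrow> 0" by (rule lim_1_over_n)
  qed (auto simp: pos less_imp_le)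
  have bdd: "\<exists>K. \<forall>A\<in>S. cmod (trace (A ** X)) \<le> K" if "X \<in> mspan S" for X
    using that
  proof induction
    case (mspan_base B)
    then show ?case using tr mult by blast
  next
    case (mspan_add A B)
    then obtain K L where KL: "\<forall>C\<in>S. cmod (trace (C ** A)) \<le> K"
      "\<forall>C\<in>S. cmod (trace (C ** B)) \<le> L" by blast
    have "cmod (trace (C ** (A + B))) \<le> K + L" if "C \<in> S" for C
      using KL that norm_triangle_ineq[of "trace (C ** A)" "trace (C ** B)"]
      by (fastforce simp: matrix_add_ldistrib trace_add)
    then show ?case by blast
  next
    case (mspan_scale A k)
    then obtain K where K: "\<forall>C\<in>S. cmod (trace (C ** A)) \<le> K" by blast
    have "cmod (trace (C ** (mat k ** A))) \<le> cmod k * K" if "C \<in> S" for C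
    proof -
      have "trace (C ** (mat k ** A)) = trace (mat k ** (A ** C))"
        by (metis trace_mul_sym matrix_mul_assoc)
      also have "\<dots> = k * trace (C ** A)"
        by (metis trace_mat_mult trace_mul_sym)
      finally show ?thesis using K that by (simp add: norm_mult mult_left_mono)
    qed
    then show ?case by blast
  qed (auto simp: trace_def intro: exI[of _ 0])
  have traceless: "trace (T ** X) = 0" if X: "X \<in> mspan S" for X
  proof -
    obtain K where K: "\<forall>A\<in>S. cmod (trace (A ** X)) \<le> K" using bdd[OF X] by blast
    have "(\<lambda>n. trace ((c \<circ> r) n ** X)) \<longlonglongrightarrow> trace (T ** X)"
      by (intro bounded_linear.tendsto[OF bounded_linear_trace]
          bounded_bilinear.tendsto[OF bounded_bilinear_matrix_mult] T(3) tendsto_const)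
    moreover have "(\<lambda>n. trace ((c \<circ> r) n ** X)) \<longlonglongrightarrow> 0"
    proof (rule Lim_null_comparison)
      show "(\<lambda>n. 1 / norm (a (r n)) * K) \<longlonglongrightarrow> 0"
        using tendsto_mult_right[OF inv0, of K] by simp
      show "\<forall>\<^sub>F n in sequentially. norm (trace ((c \<circ> r) n ** X)) \<le> 1 / norm (a (r n)) * K"
      proof (rule always_eventually, rule allI)
        fix n
        have "trace ((c \<circ> r) n ** X) = (1 / norm (a (r n))) *\<^sub>R trace (a (r n) ** X)"
          by (simp add: c_def scalar_matrix_assoc[symmetric]
              linear_scale[OF bounded_linear.linear[OF bounded_linear_trace]])
        moreover have "cmod (trace (a (r n) ** X)) \<le> K" using K a(1) by blast
        ultimately show "norm (trace ((c \<circ> r) n ** X)) \<le> 1 / norm (a (r n)) * K"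
          using pos[of "r n"] by (simp add: divide_right_mono)
      qed
    qed
    ultimately show ?thesis by (rule LIMSEQ_unique)
  qed
  \<comment> \<open>The orthogonality to the span extends to its closure, which contains \<open>T\<close>.\<close>
  have traceless': "trace (T ** X) = 0" if Xc: "X \<in> closure (mspan S)" for X
  proof -
    obtain x where x: "\<forall>n. x n \<in> mspan S" "x \<longlonglongrightarrow> X"
      using iffD1[OF closure_sequential Xc] by blast
    have "(\<lambda>n. trace (T ** x n)) \<longlonglongrightarrow> trace (T ** X)"
      by (intro bounded_linear.tendsto[OF bounded_linear_trace]
          bounded_bilinear.tendsto[OF bounded_bilinear_matrix_mult] x(2) tendsto_const)
    then show ?thesis using traceless x(1) by (simp add: LIMSEQ_const_iff)
  qed
  have Tcl: "T \<in> closure (mspan S)"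
  proof -
    have "(c \<circ> r) n \<in> mspan S" for n
    proof -
      have "c (r n) = mat (of_real (1 / norm (a (r n)))) ** a (r n)"
        by (simp add: c_def vec_eq_iff mat_matrix_mult_nth scaleR_conv_of_real[where 'a = complex])
      then show ?thesis using mspan_scale[OF mspan_base[OF a(1)]] by simp
    qed
    then show ?thesis
      using T(3) by (intro iffD2[OF closure_sequential] exI[of _ "c \<circ> r"]) blast
  qed
  have "T \<noteq> 0" using T(1) by auto
  then obtain y where y: "T *v y \<noteq> 0" by (metis matrix_eq matrix_vector_mult_0)
  obtain X where X: "X \<in> mspan S" "X *v (T *v y) = y" using trans[OF y] by blast
  have Xcl: "X \<in> closure (mspan S)" using X(1) closure_subset by blast
  have clm: "A ** B \<in> closure (mspan S)"
    if "A \<in> closure (mspan S)" "B \<in> closure (mspan S)" for A B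
    using closure_mspan_mult[of S A B] mult that by blast
  have "trace (T ** X) = 0" by (rule traceless[OF X(1)])
  moreover have "trace ((T ** X) ** (T ** X)) = 0"
    using traceless'[OF clm[OF Xcl clm[OF Tcl Xcl]]] by (simp add: matrix_mul_assoc)
  moreover have "trace ((T ** X) ** (T ** X) ** (T ** X)) = 0"
    using traceless'[OF clm[OF Xcl clm[OF Tcl clm[OF Xcl clm[OF Tcl Xcl]]]]]
    by (simp add: matrix_mul_assoc)
  moreover have "(T ** X) *v (T *v y) = T *v y"
    using X(2) by (simp add: matrix_vector_mul_assoc[symmetric])
  ultimately show False using newton y by blast
qed

section \<open>Matrix groups and flags\<close>

lemma matrix_inv_unique:
  fixes A :: "'a::field^'n^'n"
  assumes "A ** B = mat 1"
  shows "matrix_inv A = B"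
proof -
  have BA: "B ** A = mat 1" using assms matrix_left_right_inverse by blast
  have "A ** matrix_inv A = mat 1 \<and> matrix_inv A ** A = mat 1"
    unfolding matrix_inv_def by (rule someI[of _ B]) (simp add: assms BA)
  then show ?thesis by (metis BA matrix_mul_assoc matrix_mul_lid matrix_mul_rid)
qed

lemma matrix_inv_cancel:
  fixes A :: "'a::field^'n^'n"
  assumes "invertible A"
  shows "A ** matrix_inv A = mat 1" "matrix_inv A ** A = mat 1"
  using assms matrix_inv_unique unfolding invertible_def by metis+

lemma mat_commute: "mat c ** A = (A :: 'a::comm_semiring_1^'n^'n) ** mat c"
  by (simp add: vec_eq_iff matrix_mult_mat_nth mat_matrix_mult_nth)

lemma mat_mat_mult: "(mat c :: 'a::semiring_1^'n^'n) ** mat d = mat (c * d)"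
  by (simp add: vec_eq_iff mat_matrix_mult_nth) (simp add: mat_def)

lemma scaled_mult_scaled:
  fixes A B :: "'a::comm_semiring_1^'n^'n"
  shows "(mat c ** A) ** (mat d ** B) = mat (c * d) ** (A ** B)"
proof -
  have "(mat c ** A) ** (mat d ** B) = mat c ** (A ** mat d) ** B"
    by (simp add: matrix_mul_assoc)
  also have "\<dots> = mat c ** (mat d ** A) ** B"
    by (simp only: mat_commute)
  also have "\<dots> = mat (c * d) ** (A ** B)"
    by (simp add: matrix_mul_assoc mat_mat_mult)
  finally show ?thesis .
qed

lemma vector_scalar_matrix_mult: "f v* (mat c :: 'a::comm_semiring_1^'n^'n) = c *s f"
  by (metis scalar_matrix_vector_mult transpose_mat transpose_matrix_vector)

definition matrix_group :: "('a::field^'n^'n) set \<Rightarrow> bool" where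
  "matrix_group S \<longleftrightarrow> mat 1 \<in> S \<and> (\<forall>A\<in>S. \<forall>B\<in>S. A ** B \<in> S)
     \<and> (\<forall>A\<in>S. invertible A \<and> matrix_inv A \<in> S)"

lemma matrix_groupD:
  assumes "matrix_group S"
  shows "mat 1 \<in> S" "A \<in> S \<Longrightarrow> B \<in> S \<Longrightarrow> A ** B \<in> S" "A \<in> S \<Longrightarrow> matrix_inv A \<in> S"
    "A \<in> S \<Longrightarrow> A ** matrix_inv A = mat 1" "A \<in> S \<Longrightarrow> matrix_inv A ** A = mat 1"
  using assms matrix_inv_cancel unfolding matrix_group_def by blast+

lemma matrix_groupI:
  assumes "mat 1 \<in> S" "\<And>A B. A \<in> S \<Longrightarrow> B \<in> S \<Longrightarrow> A ** B \<in> S"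
    "\<And>A. A \<in> S \<Longrightarrow> \<exists>B\<in>S. A ** B = mat 1"
  shows "matrix_group S"
proof -
  have "invertible A \<and> matrix_inv A \<in> S" if "A \<in> S" for A
    using assms(3)[OF that] matrix_inv_unique invertible_right_inverse by metis
  then show ?thesis using assms(1,2) unfolding matrix_group_def by blast
qed

text \<open>When \<open>pairing f v = 0\<close>, the flag consists of the point spanned by \<open>v\<close> in the line given by the kernel of \<open>f\<close>.\<close>

definition fixes_flag :: "'a::field^'n \<Rightarrow> 'a^'n \<Rightarrow> 'a^'n^'n \<Rightarrow> bool" where
  "fixes_flag v f A \<longleftrightarrow> (\<exists>c. A *v v = c *s v) \<and> (\<exists>d. f v* A = d *s f)"

text \<open>Requiring all conjugates to fix the flag makes this a statement about the normal core of the stabiliser: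
the core has finite index, with every coset represented in \<open>T\<close>.\<close>

definition virtually_fixes_flag :: "('a::field^'n^'n) set \<Rightarrow> 'a^'n \<Rightarrow> 'a^'n \<Rightarrow> bool" where
  "virtually_fixes_flag S v f \<longleftrightarrow> (\<exists>T. finite T \<and> T \<subseteq> S \<and> (\<forall>A\<in>S. \<exists>B\<in>T. \<forall>C\<in>S.
     fixes_flag v f (C ** (A ** matrix_inv B) ** matrix_inv C)))"

lemma fixes_flag_scalar: "fixes_flag v f (mat c)"
  unfolding fixes_flag_def by (metis scalar_matrix_vector_mult vector_scalar_matrix_mult)

lemma fixes_flag_transpose: "fixes_flag f v (transpose A) \<longleftrightarrow> fixes_flag v f A"
  unfolding fixes_flag_def by auto

text \<open>The pigeonhole principle behind all finiteness of index below.\<close>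

lemma bounded_finite_net:
  fixes X :: "'a::euclidean_space set"
  assumes "bounded X" "0 < e"
  shows "\<exists>T. finite T \<and> T \<subseteq> X \<and> (\<forall>x\<in>X. \<exists>t\<in>T. dist t x < e)"
proof -
  have "compact (closure X)" using assms(1) by simp
  moreover have "closure X \<subseteq> (\<Union>x\<in>X. ball x e)"
    using assms(2) closure_approachable[of _ X] by (auto simp: dist_commute)
  ultimately obtain T where "T \<subseteq> X" "finite T" "closure X \<subseteq> (\<Union>x\<in>T. ball x e)"
    by (elim compactE_image[where f = "\<lambda>x. ball x e"]) auto
  then show ?thesis using closure_subset[of X] by (intro exI[of _ T]) fastforce
qed

lemma proportional_if_minors_vanish:
  fixes y z :: "'a::field^'n"
  assumes "y \<noteq> 0" "\<And>i j. y $ i * z $ j = y $ j * z $ i"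
  shows "\<exists>c. z = c *s y"
proof -
  obtain k where k: "y $ k \<noteq> 0" using assms(1) by (auto simp: vec_eq_iff)
  have "z = (z $ k / y $ k) *s y"
    using assms(2)[of k] k by (simp add: vec_eq_iff field_simps)
  then show ?thesis ..
qed

lemma annihilators_proportional_2:
  fixes f h y :: "'a::field^2"
  assumes "pairing f y = 0" "pairing h y = 0" "f \<noteq> 0" "y \<noteq> 0"
  shows "\<exists>c. h = c *s f"
proof (rule proportional_if_minors_vanish[OF assms(3)])
  have e: "f $ 1 * y $ 1 + f $ 2 * y $ 2 = 0" "h $ 1 * y $ 1 + h $ 2 * y $ 2 = 0"
    using assms(1,2) by (simp_all add: pairing_def sum_2)
  have "y $ 1 * (f $ 1 * h $ 2 - f $ 2 * h $ 1) = 0"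
    "y $ 2 * (f $ 1 * h $ 2 - f $ 2 * h $ 1) = 0" using e by algebra+
  moreover have "y $ 1 \<noteq> 0 \<or> y $ 2 \<noteq> 0" using assms(4) by (auto simp: vec_eq_iff forall_2)
  ultimately have "f $ 1 * h $ 2 = f $ 2 * h $ 1" by auto
  then show "f $ i * h $ j = f $ j * h $ i" for i j
    using exhaust_2[of i] exhaust_2[of j] by auto
qed

text \<open>Unless \<open>y\<close> and \<open>z\<close> are proportional, the row vectors killing both are the multiples of the cross product of
\<open>y\<close> and \<open>z\<close>, called \<open>n\<close> in the proof.\<close>

lemma annihilators_proportional_3:
  fixes f h y z :: "'a::field^3"
  assumes "pairing f y = 0" "pairing f z = 0" "pairing h y = 0" "pairing h z = 0"
    and "f \<noteq> 0" "y \<noteq> 0"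
  shows "(\<exists>c. z = c *s y) \<or> (\<exists>c. h = c *s f)"
proof -
  define n :: "'a^3" where "n = vector [y$2 * z$3 - y$3 * z$2, y$3 * z$1 - y$1 * z$3, y$1 * z$2 - y$2 * z$1]"
  have n: "n $ 1 = y$2 * z$3 - y$3 * z$2" "n $ 2 = y$3 * z$1 - y$1 * z$3"
    "n $ 3 = y$1 * z$2 - y$2 * z$1" by (simp_all add: n_def)
  show ?thesis
  proof (cases "n = 0")
    case True
    then have "y$2 * z$3 = y$3 * z$2" "y$3 * z$1 = y$1 * z$3" "y$1 * z$2 = y$2 * z$1"
      using n by (simp_all add: vec_eq_iff forall_3)
    then have "y $ i * z $ j = y $ j * z $ i" for i j
      using exhaust_3[of i] exhaust_3[of j] by auto
    then show ?thesis using proportional_if_minors_vanish[OF assms(6)] by blast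
  next
    case False
    have par: "\<exists>c. g = c *s n" if "pairing g y = 0" "pairing g z = 0" for g
    proof (rule proportional_if_minors_vanish[OF False])
      have e: "g$1 * y$1 + g$2 * y$2 + g$3 * y$3 = 0" "g$1 * z$1 + g$2 * z$2 + g$3 * z$3 = 0"
        using that by (simp_all add: pairing_def sum_3)
      have "n$1 * g$2 = n$2 * g$1" "n$1 * g$3 = n$3 * g$1" "n$2 * g$3 = n$3 * g$2"
        unfolding n using e by algebra+
      then show "n $ i * g $ j = n $ j * g $ i" for i j
        using exhaust_3[of i] exhaust_3[of j] by auto
    qed
    obtain a b where ab: "f = a *s n" "h = b *s n" using par assms by metis
    have "a \<noteq> 0" using ab assms(5) by auto
    then have "h = (b / a) *s f" by (simp add: ab)
    then show ?thesis by blast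
  qed
qed

text \<open>Otherwise some row vector \<open>f\<close> kills the orbit of \<open>y\<close>. If \<open>f\<close> is moved to a different direction
by the group, the translates of \<open>f\<close> cut the orbit down to a line, so that \<open>y\<close> is a common eigenvector.\<close>

lemma irreducible_if_no_common_eigenvectors_3:
  fixes S :: "('a::field^3^3) set"
  assumes S: "matrix_group S"
    and right: "\<And>v. v \<noteq> 0 \<Longrightarrow> \<exists>A\<in>S. \<forall>c. A *v v \<noteq> c *s v"
    and left: "\<And>f. f \<noteq> 0 \<Longrightarrow> \<exists>A\<in>S. \<forall>c. f v* A \<noteq> c *s f"
    and "y \<noteq> 0"
  shows "\<exists>X. X \<in> mspan S \<and> X *v y = x"
proof (rule ccontr)
  assume "\<nexists>X. X \<in> mspan S \<and> X *v y = x"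
  then obtain f where f: "f \<noteq> 0" "\<And>A. A \<in> S \<Longrightarrow> pairing f (A *v y) = 0"
    using orbit_annihilator by metis
  obtain A where A: "A \<in> S" "\<forall>c. f v* A \<noteq> c *s f" using left[OF f(1)] by blast
  obtain B where B: "B \<in> S" "\<forall>c. B *v y \<noteq> c *s y" using right[OF \<open>y \<noteq> 0\<close>] by blast
  have "pairing f y = 0" using f(2)[OF matrix_groupD(1)[OF S]] by simp
  moreover have "pairing (f v* A) y = 0" "pairing (f v* A) (B *v y) = 0"
    using f(2) A(1) B(1) matrix_groupD(2)[OF S A(1) B(1)]
    by (simp_all add: pairing_vector_matrix matrix_vector_mul_assoc)
  ultimately show False
    using annihilators_proportional_3[of f y "B *v y" "f v* A"] f(1) f(2)[OF B(1)] \<open>y \<noteq> 0\<close> A(2) B(2)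
    by blast
qed

section \<open>Discrete groups with unimodular eigenvalues: the irreducible case\<close>

text \<open>Discreteness is stated modulo scalars, as it comes from the projective group. The assumptions are
chosen to carry over to the transposed group, so that the two reducible cases are dual to each other.\<close>

locale discrete_unimodular_group =
  fixes \<Gamma> :: "(complex^3^3) set" and \<delta> :: real
  assumes group: "matrix_group \<Gamma>"
    and delta_pos: "0 < \<delta>"
    and discrete: "A \<in> \<Gamma> \<Longrightarrow> norm (A - mat 1) < \<delta> \<Longrightarrow> \<exists>c. A = mat c"
    and unimodular: "A \<in> \<Gamma> \<Longrightarrow> matrix_eigenvalue A c \<Longrightarrow> cmod c = 1"
begin

lemmas one_in = matrix_groupD(1)[OF group]
  and mult_in = matrix_groupD(2)[OF group]
  and inv_in = matrix_groupD(3)[OF group]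
  and right_inv = matrix_groupD(4)[OF group]
  and left_inv = matrix_groupD(5)[OF group]

text \<open>If \<open>A\<close> and \<open>B\<close> are close in a bounded group, \<open>A ** matrix_inv B\<close> is close to 1, hence a scalar by discreteness, and
scalars fix every flag.\<close>

lemma irreducible_case:
  assumes right: "\<And>v. v \<noteq> 0 \<Longrightarrow> \<exists>A\<in>\<Gamma>. \<forall>c. A *v v \<noteq> c *s v"
    and left: "\<And>f. f \<noteq> 0 \<Longrightarrow> \<exists>A\<in>\<Gamma>. \<forall>c. f v* A \<noteq> c *s f"
  shows "virtually_fixes_flag \<Gamma> v f"
proof -
  have "bounded \<Gamma>"
  proof (rule bounded_if_irreducible_bounded_trace)
    show "cmod (trace A) \<le> 3" if "A \<in> \<Gamma>" for A
      by (rule cmod_trace_le_3) (rule unimodular[OF that])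
    show "\<exists>X. X \<in> mspan \<Gamma> \<and> X *v y = x" if "y \<noteq> 0" for x y
      by (rule irreducible_if_no_common_eigenvectors_3[OF group right left that])
  qed (use mult_in traceless_powers_no_fixed_vector_3 in auto)
  then obtain K where K: "K > 0" "\<And>A. A \<in> \<Gamma> \<Longrightarrow> norm A \<le> K"
    unfolding bounded_pos by blast
  obtain T where T: "finite T" "T \<subseteq> \<Gamma>" "\<And>A. A \<in> \<Gamma> \<Longrightarrow> \<exists>B\<in>T. dist B A < \<delta> / K"
    using bounded_finite_net[OF \<open>bounded \<Gamma>\<close>, of "\<delta> / K"] K(1) delta_pos by auto
  have "\<exists>B\<in>T. \<forall>C\<in>\<Gamma>. fixes_flag v f (C ** (A ** matrix_inv B) ** matrix_inv C)" if A: "A \<in> \<Gamma>" for A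
  proof -
    obtain B where B: "B \<in> T" "dist B A < \<delta> / K" using T(3)[OF A] by blast
    then have B\<Gamma>: "B \<in> \<Gamma>" using T(2) by blast
    have "norm (A ** matrix_inv B - mat 1) = norm ((A - B) ** matrix_inv B)"
      by (simp add: right_inv[OF B\<Gamma>] bounded_bilinear.diff_left[OF bounded_bilinear_matrix_mult])
    also have "\<dots> \<le> norm (A - B) * norm (matrix_inv B)" by (rule norm_matrix_mult_le)
    also have "\<dots> \<le> norm (A - B) * K"
      by (intro mult_left_mono K(2) inv_in B\<Gamma>) simp
    also have "\<dots> < \<delta>" using B(2) K(1) by (simp add: dist_norm norm_minus_commute field_simps)
    finally obtain c where c: "A ** matrix_inv B = mat c"
      using discrete mult_in[OF A inv_in[OF B\<Gamma>]] by blast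
    have "C ** (A ** matrix_inv B) ** matrix_inv C = mat c" if "C \<in> \<Gamma>" for C
      unfolding c by (metis mat_commute matrix_mul_assoc matrix_mul_rid right_inv that)
    then show ?thesis using B(1) fixes_flag_scalar by metis
  qed
  then show ?thesis unfolding virtually_fixes_flag_def using T(1,2) by blast
qed

end

section \<open>Commutation of \<open>2 \<times> 2\<close> matrices and coordinates on a quotient\<close>

lemma char_poly_2:
  fixes A :: "'a::field^2^2"
  shows "det (mat x - A) = x\<^sup>2 - trace A * x + det A"
  by (simp add: det_2 trace_def sum_2 mat_def power2_eq_square) algebra

lemma left_eigenvector_exists_2:
  fixes U :: "complex^2^2"
  shows "\<exists>\<phi> c. \<phi> \<noteq> 0 \<and> \<phi> v* U = c *s \<phi>"
proof -
  define c where "c = (trace U + csqrt ((trace U)\<^sup>2 - 4 * det U)) / 2"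
  have "csqrt ((trace U)\<^sup>2 - 4 * det U) = 2 * c - trace U"
    by (simp add: c_def field_simps)
  then have "(2 * c - trace U)\<^sup>2 = (trace U)\<^sup>2 - 4 * det U" by (metis power2_csqrt)
  then have "4 * (c\<^sup>2 - trace U * c + det U) = 0" by algebra
  then have "c\<^sup>2 - trace U * c + det U = 0" by (simp only: mult_eq_0_iff) simp
  then have "det (transpose (mat c - U)) = 0" by (simp add: char_poly_2)
  then obtain \<phi> where "\<phi> \<noteq> 0" "transpose (mat c - U) *v \<phi> = 0"
    using singular_iff_kernel by metis
  moreover from this(2) have "\<phi> v* U = c *s \<phi>"
    by (simp add: vector_matrix_mult_diff_rdistrib vector_scalar_matrix_mult)
  ultimately show ?thesis by blast
qed

text \<open>The commutant of a nonscalar \<open>2 \<times> 2\<close> matrix consists of the polynomials in it.\<close>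

lemma commutant_2:
  fixes U W :: "'a::field^2^2"
  assumes comm: "U ** W = W ** U" and nonscalar: "\<And>c. U \<noteq> mat c"
  shows "\<exists>x y. W = mat x + mat y ** U"
proof -
  have e: "U$1$2 * W$2$1 = U$2$1 * W$1$2" "(U$1$1 - U$2$2) * W$1$2 = U$1$2 * (W$1$1 - W$2$2)"
    "(U$1$1 - U$2$2) * W$2$1 = U$2$1 * (W$1$1 - W$2$2)"
  proof -
    have "(U ** W) $ i $ j = (W ** U) $ i $ j" for i j using comm by simp
    note this[of 1 1] this[of 1 2] this[of 2 1]
    then have "U$1$1 * W$1$1 + U$1$2 * W$2$1 = W$1$1 * U$1$1 + W$1$2 * U$2$1"
      "U$1$1 * W$1$2 + U$1$2 * W$2$2 = W$1$1 * U$1$2 + W$1$2 * U$2$2"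
      "U$2$1 * W$1$1 + U$2$2 * W$2$1 = W$2$1 * U$1$1 + W$2$2 * U$2$1"
      by (simp_all add: matrix_matrix_mult_def sum_2)
    then show "U$1$2 * W$2$1 = U$2$1 * W$1$2"
      "(U$1$1 - U$2$2) * W$1$2 = U$1$2 * (W$1$1 - W$2$2)"
      "(U$1$1 - U$2$2) * W$2$1 = U$2$1 * (W$1$1 - W$2$2)" by algebra+
  qed
  have "W = mat (W$1$1 - y * U$1$1) + mat y ** U"
    if "W$1$2 = y * U$1$2" "W$2$1 = y * U$2$1" "W$1$1 - W$2$2 = y * (U$1$1 - U$2$2)" for y
    using that by (simp add: vec_eq_iff forall_2 mat_matrix_mult_nth) (simp add: mat_def algebra_simps)
  moreover have "\<exists>y. W$1$2 = y * U$1$2 \<and> W$2$1 = y * U$2$1 \<and> W$1$1 - W$2$2 = y * (U$1$1 - U$2$2)"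
  proof -
    consider "U$1$2 \<noteq> 0" | "U$2$1 \<noteq> 0" | "U$1$2 = 0" "U$2$1 = 0" "U$1$1 \<noteq> U$2$2"
    proof -
      have "U$1$2 \<noteq> 0 \<or> U$2$1 \<noteq> 0 \<or> U$1$1 \<noteq> U$2$2"
        using nonscalar[of "U$1$1"] by (auto simp: vec_eq_iff forall_2 mat_def)
      then show ?thesis using that by blast
    qed
    then show ?thesis
    proof cases
      case 1 then show ?thesis using e by (intro exI[of _ "W$1$2 / U$1$2"]) (simp add: field_simps)
    next
      case 2 then show ?thesis using e by (intro exI[of _ "W$2$1 / U$2$1"]) (simp add: field_simps)
    next
      case 3 then show ?thesis
        using e by (intro exI[of _ "(W$1$1 - W$2$2) / (U$1$1 - U$2$2)"]) (simp add: field_simps)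
    qed
  qed
  ultimately show ?thesis by blast
qed

text \<open>A form of Frobenius' lemma. \<open>U\<close> has two different eigenvalues, so a conjugate that commutes with \<open>U\<close> has the same two
eigenlines, and \<open>V\<close> either preserves or exchanges them. If it exchanges them, its trace is 0. Writing the conjugate
as \<open>x + y U\<close>, comparison of traces leaves only these two possibilities, \<open>y = 1\<close> and \<open>y = - 1\<close>.\<close>

lemma commutes_if_commutes_with_conjugate_2:
  fixes U V V' :: "complex^2^2"
  assumes V: "V ** V' = mat 1" and disc: "(trace U)\<^sup>2 \<noteq> 4 * det U" and trV: "trace V \<noteq> 0"
    and comm: "U ** (V ** U ** V') = (V ** U ** V') ** U"
  shows "U ** V = V ** U"
proof -
  have V'V: "V' ** V = mat 1" using V matrix_left_right_inverse by blast
  have nonscalar: "U \<noteq> mat c" for c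
    using disc by (auto simp: det_2 trace_def sum_2 mat_def power2_eq_square)
  define W where "W = V ** U ** V'"
  obtain x y where W: "W = mat x + mat y ** U"
    using commutant_2[OF comm nonscalar] unfolding W_def by blast
  have WV: "W ** V = V ** U"
    unfolding W_def by (metis V'V matrix_mul_assoc matrix_mul_rid)
  have "trace W = trace U"
    unfolding W_def by (metis V'V matrix_mul_assoc matrix_mul_lid trace_mul_sym)
  then have t1: "2 * x + y * trace U = trace U"
    by (simp add: W trace_add trace_mat_mult) (simp add: trace_def mat_def)
  have "W ** W = V ** (U ** U) ** V'"
    unfolding W_def by (metis V'V matrix_mul_assoc matrix_mul_rid)
  then have "trace (W ** W) = trace (U ** U)"
    by (metis V'V matrix_mul_assoc matrix_mul_lid trace_mul_sym)
  moreover have "W ** W = mat (x * x) + mat (2 * x * y) ** U + mat (y * y) ** (U ** U)"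
    unfolding W
    by (simp add: vec_eq_iff forall_2 matrix_matrix_mult_def sum_2 mat_def algebra_simps)
  ultimately have t2: "2 * (x * x) + 2 * x * y * trace U + y * y * trace (U ** U) = trace (U ** U)"
    by (simp add: trace_add trace_mat_mult) (simp add: trace_def mat_def)
  have s: "trace (U ** U) = (trace U)\<^sup>2 - 2 * det U"
    by (simp add: trace_def sum_2 det_2 matrix_matrix_mult_def power2_eq_square) algebra
  have "(1 - y) * (1 + y) * ((trace U)\<^sup>2 - 4 * det U) = 0"
  proof -
    have "(1 - y) * (1 + y) * (t\<^sup>2 - 4 * d) = 0"
      if "2 * x + y * t = t" "2 * (x * x) + 2 * x * y * t + y * y * (t\<^sup>2 - 2 * d) = t\<^sup>2 - 2 * d"
      for t d :: complex
    proof -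
      have "(1 - y) * (1 + y) * (t\<^sup>2 - 4 * d)
          = (2 * x + y * t + t) * (2 * x + y * t - t)
            - 2 * (2 * (x * x) + 2 * x * y * t + y * y * (t\<^sup>2 - 2 * d) - (t\<^sup>2 - 2 * d))"
        by (simp add: power2_eq_square algebra_simps)
      then show ?thesis using that by simp
    qed
    then show ?thesis using t1 t2 unfolding s by blast
  qed
  then have "y = 1 \<or> y = - 1" using disc by (auto simp: eq_neg_iff_add_eq_0 add.commute)
  then show ?thesis
  proof
    assume "y = 1"
    then have "W = U" using W t1 by simp
    then show ?thesis using WV by simp
  next
    assume y: "y = - 1"
    then have x: "x = trace U" using t1 by simp
    have e: "(mat (trace U) + mat (- 1) ** U) ** V = V ** U" using WV unfolding W x y .
    have "U$1$2 * trace V = 0" "U$2$1 * trace V = 0"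
      using e by (simp_all add: vec_eq_iff forall_2 matrix_matrix_mult_def sum_2 mat_def trace_def
          algebra_simps)
    then have off: "U$1$2 = 0" "U$2$1 = 0" using trV by auto
    then have "U$1$1 \<noteq> U$2$2"
      using disc by (auto simp: det_2 trace_def sum_2 power2_eq_square)
    moreover have "(U$1$1 - U$2$2) * V$1$1 = 0" "(U$1$1 - U$2$2) * V$2$2 = 0"
      using e off by (auto simp: vec_eq_iff forall_2 matrix_matrix_mult_def sum_2 mat_def trace_def
          algebra_simps)
    ultimately have "V$1$1 = 0" "V$2$2 = 0" by auto
    then show ?thesis using trV by (simp add: trace_def sum_2)
  qed
qed

lemma commutes_with_conjugate_if_commutes_with_commutator:
  fixes U V U' V' :: "'a::field^'n^'n"
  assumes U: "U ** U' = mat 1" and V: "V ** V' = mat 1"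
    and comm: "U ** (U ** V ** U' ** V') = (U ** V ** U' ** V') ** U"
  shows "U ** (V ** U ** V') = (V ** U ** V') ** U"
proof -
  have inv: "U' ** U = mat 1" "V' ** V = mat 1" using U V matrix_left_right_inverse by blast+
  define Y where "Y = V ** U' ** V'"
  define Z where "Z = V ** U ** V'"
  have YZ: "Y ** Z = mat 1" "Z ** Y = mat 1"
    unfolding Y_def Z_def by (metis U V inv matrix_mul_assoc matrix_mul_rid)+
  have "U' ** (U ** (U ** Y)) = U' ** ((U ** Y) ** U)"
    using comm by (simp add: Y_def matrix_mul_assoc)
  then have "U ** Y = Y ** U" by (metis inv(1) matrix_mul_assoc matrix_mul_lid)
  then have "Z ** (U ** Y) ** Z = Z ** (Y ** U) ** Z" by simp
  then have "Z ** U = U ** Z" by (metis YZ matrix_mul_assoc matrix_mul_lid matrix_mul_rid)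
  then show ?thesis by (simp add: Z_def)
qed

lemma norm_entry_le: "norm (X $ i $ j) \<le> norm (X :: complex^'n^'m)"
  by (meson Finite_Cartesian_Product.norm_nth_le order_trans)

text \<open>The discriminant of \<open>U\<close> vanishes, so \<open>U = c + n\<close> with \<open>n\<^sup>2 = 0\<close>; the powers \<open>c\<^sup>k + k c\<^sup>k\<^sup>-\<^sup>1 n\<close>
grow linearly when \<open>|c| = 1\<close>, unless \<open>n = 0\<close>.\<close>

lemma bounded_powers_semisimple_2:
  fixes S :: "(complex^2^2) set"
  assumes mult: "\<And>A B. A \<in> S \<Longrightarrow> B \<in> S \<Longrightarrow> A ** B \<in> S" and bdd: "bounded S"
    and U: "U \<in> S" and disc: "(trace U)\<^sup>2 = 4 * det U" and unit: "cmod (trace U / 2) = 1"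
  shows "U = mat (trace U / 2)"
proof -
  define c where "c = trace U / 2"
  define n where "n = U - mat c"
  have nn: "n ** n = 0"
  proof -
    have "trace U = 2 * c" "det U = c * c"
      using disc by (simp_all add: c_def power2_eq_square)
    then have e: "U$1$1 + U$2$2 = 2 * c" "U$1$1 * U$2$2 - U$1$2 * U$2$1 = c * c"
      by (simp_all add: trace_def sum_2 det_2)
    have "(U$1$1 - c) * (U$1$1 - c) + U$1$2 * U$2$1 = 0"
      "(U$1$1 - c) * U$1$2 + U$1$2 * (U$2$2 - c) = 0"
      "U$2$1 * (U$1$1 - c) + (U$2$2 - c) * U$2$1 = 0"
      "U$2$1 * U$1$2 + (U$2$2 - c) * (U$2$2 - c) = 0" using e by algebra+
    then show ?thesis
      by (simp add: n_def vec_eq_iff forall_2 matrix_matrix_mult_def sum_2 mat_def)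
  qed
  have pow: "mat (c ^ Suc k) + mat (of_nat (Suc k) * c ^ k) ** n \<in> S" for k
  proof (induction k)
    case 0
    then show ?case using U by (simp add: n_def)
  next
    case (Suc k)
    have "(mat (c ^ Suc k) + mat (of_nat (Suc k) * c ^ k) ** n) ** U
        = (mat (c ^ Suc k) + mat (of_nat (Suc k) * c ^ k) ** n) ** (mat c + n)"
      by (simp add: n_def)
    also have "\<dots> = mat (c ^ Suc k * c) + mat (of_nat (Suc k) * c ^ k * c) ** n
        + mat (c ^ Suc k) ** n + mat (of_nat (Suc k) * c ^ k) ** (n ** n)"
      by (simp add: matrix_add_ldistrib matrix_add_rdistrib mat_mat_mult matrix_mul_assoc[symmetric])
        (simp add: mat_commute[of c n, symmetric] matrix_mul_assoc mat_mat_mult)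
    also have "\<dots> = mat (c ^ Suc (Suc k)) + mat (of_nat (Suc (Suc k)) * c ^ Suc k) ** n"
      unfolding nn by (simp add: vec_eq_iff mat_matrix_mult_nth) (simp add: mat_def algebra_simps)
    finally show ?case using mult[OF Suc.IH U] by simp
  qed
  obtain K where K: "\<And>A. A \<in> S \<Longrightarrow> norm A \<le> K" using bdd unfolding bounded_iff by blast
  have c1: "cmod c = 1" using unit by (simp add: c_def)
  have "n $ i $ j = 0" for i j
  proof (rule ccontr)
    assume "n $ i $ j \<noteq> 0"
    then obtain k where k: "K + 1 < of_nat k * cmod (n $ i $ j)"
      using reals_Archimedean3[of "cmod (n $ i $ j)"] by auto
    let ?P = "mat (c ^ Suc k) + mat (of_nat (Suc k) * c ^ k) ** n"
    let ?d = "(mat (c ^ Suc k) :: complex^2^2) $ i $ j"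
    have "real (Suc k) * cmod (n $ i $ j) = cmod (?P $ i $ j - ?d)"
      by (simp add: mat_matrix_mult_nth norm_mult norm_power c1 del: of_nat_Suc)
    also have "\<dots> \<le> norm ?P + cmod ?d"
      using norm_triangle_ineq4[of "?P $ i $ j" ?d] norm_entry_le[of ?P i j] by linarith
    also have "\<dots> \<le> K + 1"
      using K[OF pow[of k]] by (intro add_mono) (auto simp: mat_def norm_mult norm_power c1)
    finally show False using k by (simp add: algebra_simps) (smt (verit) norm_ge_zero)
  qed
  then have "n = 0" by (simp add: vec_eq_iff)
  then show ?thesis by (simp add: n_def c_def)
qed

text \<open>If some member is not scalar, the others are polynomials in it and share its eigenvectors.\<close>

lemma commuting_family_common_left_eigenvector_2:
  fixes Z :: "(complex^2^2) set"
  assumes "\<And>U W. U \<in> Z \<Longrightarrow> W \<in> Z \<Longrightarrow> U ** W = W ** U"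
  shows "\<exists>\<phi>. \<phi> \<noteq> 0 \<and> (\<forall>W\<in>Z. \<exists>d. \<phi> v* W = d *s \<phi>)"
proof (cases "\<forall>U\<in>Z. \<exists>c. U = mat c")
  case True
  then have "\<forall>W\<in>Z. \<exists>d. axis 1 1 v* W = d *s axis 1 1" by (metis vector_scalar_matrix_mult)
  then show ?thesis by (metis axis_eq_0_iff zero_neq_one)
next
  case False
  then obtain U where U: "U \<in> Z" "\<And>c. U \<noteq> mat c" by blast
  obtain \<phi> c where \<phi>: "\<phi> \<noteq> 0" "\<phi> v* U = c *s \<phi>" using left_eigenvector_exists_2 by blast
  have "\<exists>d. \<phi> v* W = d *s \<phi>" if W: "W \<in> Z" for W
  proof -
    obtain x y where xy: "W = mat x + mat y ** U"
      using commutant_2[OF assms[OF U(1) W] U(2)] by blast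
    have "\<phi> v* W = (x + y * c) *s \<phi>"
      unfolding xy vector_matrix_mult_add_rdistrib vector_matrix_mul_assoc[symmetric]
      by (simp add: vector_scalar_matrix_mult scalar_vector_matrix_assoc \<phi>(2) vector_sadd_rdistrib
          vector_smult_assoc)
    then show ?thesis ..
  qed
  then show ?thesis using \<phi>(1) by blast
qed

text \<open>\<open>J\<close> gives coordinates on the quotient of the space by the line spanned by \<open>v\<close>, and \<open>R\<close> is a section. If \<open>v $ k \<noteq> 0\<close>, one can
use the two coordinates other than \<open>k\<close>.\<close>

lemma quotient_coordinates:
  fixes v :: "'a::field^3"
  assumes "v \<noteq> 0"
  obtains J :: "'a^3^2" and R :: "'a^2^3" and g :: "'a^3"
  where "J ** R = mat 1" "J *v v = 0" "\<And>x. x = R *v (J *v x) + pairing g x *s v"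
proof -
  obtain i j k where ijk: "v $ k \<noteq> 0" "UNIV = {i, j, k :: 3}" "i \<noteq> j" "i \<noteq> k" "j \<noteq> k"
  proof -
    have u: "UNIV = {2, 3, 1 :: 3}" "UNIV = {1, 3, 2 :: 3}" by (auto simp: UNIV_3)
    consider "v $ 1 \<noteq> 0" | "v $ 2 \<noteq> 0" | "v $ 3 \<noteq> 0"
      using assms by (auto simp: vec_eq_iff forall_3)
    then show ?thesis
      by cases (rule that, assumption, rule u UNIV_3, simp_all)+
  qed
  have sum: "sum F UNIV = F i + F j + F k" for F :: "3 \<Rightarrow> 'a"
    unfolding ijk(2) using ijk(3-5) by simp
  have all: "(\<forall>m. P m) \<longleftrightarrow> P i \<and> P j \<and> P k" for P :: "3 \<Rightarrow> bool"
    using ijk(2) by (metis UNIV_I empty_iff insert_iff)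
  define J :: "'a^3^2" where "J = (\<chi> a m. (if m = (if a = 1 then i else j) then 1 else 0)
    - (if m = k then v $ (if a = 1 then i else j) / v $ k else 0))"
  define R :: "'a^2^3" where "R = (\<chi> m a. if m = k then 0 else if (m = i) = (a = 1) then 1 else 0)"
  define g :: "'a^3" where "g = (1 / v $ k) *s axis k 1"
  note defs = J_def R_def g_def matrix_matrix_mult_def matrix_vector_mult_def vec_eq_iff forall_2
    all sum sum_2 mat_def pairing_def axis_def
  show ?thesis
  proof
    show "J ** R = mat 1" using ijk(3-5) by (simp add: defs)
    show "J *v v = 0" using ijk by (simp add: defs)
    show "x = R *v (J *v x) + pairing g x *s v" for x
      using ijk by (simp add: defs)
  qed
qed

section \<open>Groups with a common eigenvector\<close>

text \<open>The group acts, after rescaling, by affine maps on the plane of all row vectors \<open>f\<close> with \<open>pairing f v = 1\<close>, and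
the blocks \<open>\<rho> A\<close> below are the linear parts.\<close>

locale affine_group = discrete_unimodular_group +
  fixes v :: "complex^3" and J :: "complex^3^2" and R :: "complex^2^3" and g :: "complex^3"
  assumes v_nonzero: "v \<noteq> 0"
    and v_eigen: "A \<in> \<Gamma> \<Longrightarrow> \<exists>c. A *v v = c *s v"
    and JR: "J ** R = mat 1" and Jv: "J *v v = 0"
    and split: "x = R *v (J *v x) + pairing g x *s v"
begin

text \<open>Dividing by the eigenvalue at \<open>v\<close> may destroy membership in \<open>\<Gamma>\<close>, but commutators do not see the scalars
and return to \<open>\<Gamma>\<close>; see \<open>commutator_in_group\<close>.\<close>

definition N :: "(complex^3^3) set" where
  "N = {B. B *v v = v \<and> (\<exists>c. cmod c = 1 \<and> mat c ** B \<in> \<Gamma>)}"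

text \<open>The matrix of \<open>A\<close> on the quotient by \<open>v\<close>.\<close>

definition \<rho> :: "complex^3^3 \<Rightarrow> complex^2^2" where
  "\<rho> A = J ** A ** R"

lemma normalise:
  assumes "A \<in> \<Gamma>"
  obtains c B where "cmod c = 1" "B \<in> N" "A = mat c ** B"
proof -
  obtain c where c: "A *v v = c *s v" using v_eigen[OF assms] by blast
  have c1: "cmod c = 1"
    using unimodular[OF assms] c v_nonzero unfolding matrix_eigenvalue_def by blast
  then have "c \<noteq> 0" by auto
  have AB: "A = mat c ** (mat (1 / c) ** A)"
    using \<open>c \<noteq> 0\<close> by (simp add: matrix_mul_assoc mat_mat_mult)
  have "(mat (1 / c) ** A) *v v = v"
    using \<open>c \<noteq> 0\<close> by (simp add: matrix_vector_mul_assoc[symmetric] scalar_matrix_vector_mult c vector_smult_assoc)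
  then have "mat (1 / c) ** A \<in> N" unfolding N_def using c1 AB assms by auto
  then show ?thesis using that c1 AB by blast
qed

lemma N_fix: "B \<in> N \<Longrightarrow> B *v v = v"
  by (simp add: N_def)

lemma group_N: "matrix_group N"
proof (rule matrix_groupI)
  show "mat 1 \<in> N" using one_in by (auto simp: N_def intro: exI[of _ 1])
next
  fix A B assume A: "A \<in> N" and B: "B \<in> N"
  obtain a b where ab: "cmod a = 1" "mat a ** A \<in> \<Gamma>" "cmod b = 1" "mat b ** B \<in> \<Gamma>"
    using A B by (auto simp: N_def)
  have "mat (a * b) ** (A ** B) = (mat a ** A) ** (mat b ** B)"
    by (simp add: scaled_mult_scaled)
  then have "mat (a * b) ** (A ** B) \<in> \<Gamma>" using mult_in[OF ab(2,4)] by simp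
  moreover have "(A ** B) *v v = v"
    using N_fix[OF A] N_fix[OF B] by (simp add: matrix_vector_mul_assoc[symmetric])
  ultimately show "A ** B \<in> N"
    unfolding N_def using ab by (auto simp: norm_mult intro!: exI[of _ "a * b"])
next
  fix A assume A: "A \<in> N"
  then obtain a where a: "cmod a = 1" "mat a ** A \<in> \<Gamma>" by (auto simp: N_def)
  then have a0: "a \<noteq> 0" by auto
  define B where "B = mat a ** matrix_inv (mat a ** A)"
  have AB: "A ** B = mat 1"
    unfolding B_def using right_inv[OF a(2)] by (metis mat_commute matrix_mul_assoc)
  then have BA: "B ** A = mat 1" using matrix_left_right_inverse by blast
  have "B *v v = v"
    using BA N_fix[OF A] by (metis matrix_vector_mul_assoc matrix_vector_mul_lid)
  moreover have "mat (1 / a) ** B \<in> \<Gamma>"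
    unfolding B_def using inv_in[OF a(2)] a0 by (simp add: matrix_mul_assoc mat_mat_mult)
  ultimately have "B \<in> N"
    unfolding N_def using a by (auto simp: norm_divide intro!: exI[of _ "1 / a"])
  then show "\<exists>B\<in>N. A ** B = mat 1" using AB by blast
qed

lemmas N_one = matrix_groupD(1)[OF group_N]
  and N_mult = matrix_groupD(2)[OF group_N]
  and N_inv = matrix_groupD(3)[OF group_N]
  and N_right_inv = matrix_groupD(4)[OF group_N]

definition comm :: "complex^3^3 \<Rightarrow> complex^3^3 \<Rightarrow> complex^3^3" where
  "comm A B = A ** B ** matrix_inv A ** matrix_inv B"

lemma commutator_in_N: "A \<in> N \<Longrightarrow> B \<in> N \<Longrightarrow> comm A B \<in> N"
  unfolding comm_def by (intro N_mult N_inv)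

lemma matrix_inv_scalar_mult:
  assumes "A \<in> N" "c \<noteq> 0"
  shows "matrix_inv (mat c ** A) = mat (1 / c) ** matrix_inv A"
proof (rule matrix_inv_unique)
  show "(mat c ** A) ** (mat (1 / c) ** matrix_inv A) = mat 1"
    using assms by (simp add: scaled_mult_scaled N_right_inv)
qed

lemma commutator_in_group:
  assumes A: "A \<in> N" and B: "B \<in> N"
  shows "comm A B \<in> \<Gamma>"
proof -
  obtain a b where ab: "cmod a = 1" "mat a ** A \<in> \<Gamma>" "cmod b = 1" "mat b ** B \<in> \<Gamma>"
    using A B by (auto simp: N_def)
  have nz: "a \<noteq> 0" "b \<noteq> 0" using ab by auto
  have "(mat a ** A) ** (mat b ** B) ** matrix_inv (mat a ** A) ** matrix_inv (mat b ** B)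
      = mat (a * b * (1 / a) * (1 / b)) ** comm A B"
    unfolding matrix_inv_scalar_mult[OF A nz(1)] matrix_inv_scalar_mult[OF B nz(2)] comm_def
      scaled_mult_scaled ..
  also have "\<dots> = comm A B" using nz by simp
  finally show ?thesis using mult_in[OF mult_in[OF mult_in[OF ab(2,4)] inv_in[OF ab(2)]] inv_in[OF ab(4)]]
    by simp
qed

lemma J_intertwine:
  assumes "A *v v = c *s v"
  shows "J ** A = \<rho> A ** J"
proof -
  have "J *v (A *v x) = (J ** A ** R) *v (J *v x)" for x
  proof -
    have "J *v (A *v x) = J *v (A *v (R *v (J *v x) + pairing g x *s v))"
      using split[of x] by simp
    also have "\<dots> = J *v (A *v (R *v (J *v x)))"
      by (simp add: matrix_vector_right_distrib vector_scalar_commute assms Jv)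
    finally show ?thesis by (simp add: matrix_vector_mul_assoc[symmetric])
  qed
  then show ?thesis unfolding \<rho>_def matrix_eq by (simp add: matrix_vector_mul_assoc)
qed

lemma factor_through_quotient:
  assumes "(A :: complex^3^3) *v v = 0"
  shows "A = A ** R ** J"
proof -
  have "A *v x = A *v (R *v (J *v x))" for x
    using arg_cong[OF split[of x], of "(*v) A"]
    by (simp add: matrix_vector_right_distrib vector_scalar_commute assms)
  then show ?thesis unfolding matrix_eq by (simp add: matrix_vector_mul_assoc matrix_mul_assoc)
qed

lemma rho_mult:
  assumes "A *v v = c *s v"
  shows "\<rho> (A ** B) = \<rho> A ** \<rho> B"
  using J_intertwine[OF assms] unfolding \<rho>_def by (metis matrix_mul_assoc)

lemma N_eigen: "B \<in> N \<Longrightarrow> B *v v = 1 *s v"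
  by (simp add: N_fix)

lemma rho_N_mult: "A \<in> N \<Longrightarrow> \<rho> (A ** B) = \<rho> A ** \<rho> B"
  by (rule rho_mult[OF N_eigen])

lemma rho_one: "\<rho> (mat 1) = mat 1"
  by (simp add: \<rho>_def JR)

lemma rho_diff: "\<rho> (A - B) = \<rho> A - \<rho> B"
  by (simp add: \<rho>_def bounded_bilinear.diff_left[OF bounded_bilinear_matrix_mult]
      bounded_bilinear.diff_right[OF bounded_bilinear_matrix_mult])

lemma rho_inv: "A \<in> N \<Longrightarrow> \<rho> A ** \<rho> (matrix_inv A) = mat 1"
  by (metis N_right_inv rho_N_mult rho_one)

lemma N_unimodular:
  assumes B: "B \<in> N" and ev: "B *v x = l *s x" and x: "x \<noteq> 0"
  shows "cmod l = 1"
proof -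
  obtain c where c: "cmod c = 1" "mat c ** B \<in> \<Gamma>" using B by (auto simp: N_def)
  have "(mat c ** B) *v x = (c * l) *s x"
    by (simp add: matrix_vector_mul_assoc[symmetric] scalar_matrix_vector_mult ev vector_smult_assoc)
  then have "cmod (c * l) = 1" using unimodular[OF c(2)] x unfolding matrix_eigenvalue_def by blast
  then show ?thesis using c(1) by (simp add: norm_mult)
qed

text \<open>For \<open>l \<noteq> 1\<close> an eigenvector of \<open>\<rho> B\<close> lifts to an eigenvector of \<open>B\<close>: correct \<open>R *v y\<close> by a multiple of \<open>v\<close>.\<close>

lemma rho_unimodular:
  assumes B: "B \<in> N" and ev: "\<rho> B *v y = l *s y" and y: "y \<noteq> 0"
  shows "cmod l = 1"
proof (cases "l = 1")
  case False
  define m where "m = pairing g (B *v (R *v y))"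
  define u where "u = R *v y + (m / (l - 1)) *s v"
  have BR: "B *v (R *v y) = l *s (R *v y) + m *s v"
  proof -
    have "J *v (B *v (R *v y)) = l *s y"
      using ev by (simp add: \<rho>_def matrix_vector_mul_assoc matrix_mul_assoc)
    then show ?thesis
      using split[of "B *v (R *v y)"] by (simp add: m_def vector_scalar_commute)
  qed
  have "m + m / (l - 1) = l * (m / (l - 1))" using False by (simp add: field_simps)
  then have "B *v u = l *s u"
    unfolding u_def matrix_vector_right_distrib vector_scalar_commute BR N_fix[OF B]
    by (simp add: vector_add_ldistrib vector_smult_assoc vector_sadd_rdistrib[symmetric] add.assoc)
  moreover have "J *v u = y"
    by (simp add: u_def matrix_vector_right_distrib vector_scalar_commute Jv
        matrix_vector_mul_assoc JR)
  then have "u \<noteq> 0" using y by auto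
  ultimately show ?thesis using N_unimodular[OF B] by blast
qed simp

text \<open>\<open>R ** J\<close> and the projection \<open>P\<close> onto the line of \<open>v\<close> add up to 1, and \<open>P\<close> contributes the eigenvalue \<open>c\<close>.\<close>

lemma trace_rho:
  assumes "A *v v = c *s v"
  shows "trace (\<rho> A) = trace A - c"
proof -
  define P :: "complex^3^3" where "P = (\<chi> p q. v $ p * g $ q)"
  have P: "P *v x = pairing g x *s v" for x
    by (simp add: P_def vec_eq_iff matrix_vector_mult_def pairing_def sum_distrib_left
        sum_distrib_right algebra_simps)
  have id: "R ** J + P = mat 1"
    unfolding matrix_eq using split
    by (simp add: matrix_vector_mult_add_rdistrib P matrix_vector_mul_assoc[symmetric])
  have "pairing g v *s v = v" using split[of v] by (simp add: Jv)
  then have gv: "pairing g v = 1" using v_nonzero by (metis vector_mul_rcancel vector_smult_lid)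
  have "trace P = 1" using gv by (simp add: P_def trace_def pairing_def mult.commute)
  moreover have "A ** P = mat c ** P"
    unfolding matrix_eq
    by (simp add: matrix_vector_mul_assoc[symmetric] P vector_scalar_commute assms
        scalar_matrix_vector_mult vector_smult_assoc mult.commute)
  ultimately have tP: "trace (A ** P) = c" by (simp add: trace_mat_mult)
  have "trace (\<rho> A) = trace (A ** (R ** J))"
    unfolding \<rho>_def by (metis matrix_mul_assoc trace_mul_sym)
  also have "\<dots> = trace A - trace (A ** P)"
    using arg_cong[OF id, of "\<lambda>X. trace (A ** X)"]
    by (simp add: matrix_add_ldistrib trace_add eq_diff_eq)
  finally show ?thesis using tP by simp
qed

lemma cmod_trace_rho_le: "B \<in> N \<Longrightarrow> cmod (trace (\<rho> B)) \<le> 4"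
proof -
  assume B: "B \<in> N"
  have "cmod (trace B) \<le> 3"
    by (rule cmod_trace_le_3) (use N_unimodular[OF B] in \<open>auto simp: matrix_eigenvalue_def\<close>)
  then show ?thesis
    using trace_rho[OF N_eigen[OF B]] norm_triangle_ineq4[of "trace B" 1] by simp
qed

text \<open>With \<open>a = A - 1\<close> and \<open>b = B - 1\<close> one has \<open>[A, B] - 1 = (a b - b a) A\<^sup>-\<^sup>1 B\<^sup>-\<^sup>1\<close>. Since \<open>a\<close> and \<open>b\<close> kill \<open>v\<close>, both products factor
through the quotient, so every term contains the linear part of \<open>a\<close> or of \<open>b\<close>.\<close>

lemma commutator_minus_one:
  assumes A: "A \<in> N" and B: "B \<in> N"
  shows "(comm A B - mat 1) ** R
    = (((A - mat 1) ** R) ** (\<rho> B - mat 1) - ((B - mat 1) ** R) ** (\<rho> A - mat 1))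
        ** \<rho> (matrix_inv A ** matrix_inv B)"
proof -
  note mm = bounded_bilinear.diff_left[OF bounded_bilinear_matrix_mult]
    bounded_bilinear.diff_right[OF bounded_bilinear_matrix_mult]
  define a b Q where "a = A - mat 1" and "b = B - mat 1" and "Q = matrix_inv A ** matrix_inv B"
  have Q: "Q \<in> N" unfolding Q_def by (intro N_mult N_inv A B)
  have av: "a *v v = 0" "b *v v = 0"
    using N_fix A B by (simp_all add: a_def b_def matrix_vector_mult_diff_rdistrib)
  have "(B ** A) ** Q = mat 1"
    unfolding Q_def using N_right_inv[OF A] N_right_inv[OF B] 
    by (metis matrix_mul_assoc matrix_mul_rid)
  then have "comm A B - mat 1 = (A ** B - B ** A) ** Q"
    by (simp add: comm_def Q_def mm matrix_mul_assoc)
  also have "A ** B - B ** A = a ** b - b ** a" by (simp add: a_def b_def mm)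
  also have "\<dots> = a ** R ** (J ** b) - b ** R ** (J ** a)"
    using factor_through_quotient[OF av(1)] factor_through_quotient[OF av(2)]
    by (metis matrix_mul_assoc)
  also have "\<dots> = (a ** R ** \<rho> b - b ** R ** \<rho> a) ** J"
    using J_intertwine[of a 0] J_intertwine[of b 0] av
    by (simp add: mm matrix_mul_assoc)
  finally have "comm A B - mat 1 = (a ** R ** \<rho> b - b ** R ** \<rho> a) ** J ** Q" .
  then have "(comm A B - mat 1) ** R = (a ** R ** \<rho> b - b ** R ** \<rho> a) ** \<rho> Q"
    by (simp add: \<rho>_def matrix_mul_assoc)
  then show ?thesis by (simp add: a_def b_def Q_def rho_diff rho_one)
qed

end

context affine_group
begin

lemma rho_image_mult: "C \<in> \<rho> ` N \<Longrightarrow> D \<in> \<rho> ` N \<Longrightarrow> C ** D \<in> \<rho> ` N"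
  by (auto simp: rho_N_mult[symmetric] intro!: imageI N_mult)

text \<open>Taking the commutator with \<open>A\<close> halves the distance of the linear part from 1, and divides that of the full matrix by 4
up to a multiple of the former.\<close>

lemma commutator_contracts:
  assumes K: "\<And>C. C \<in> N \<Longrightarrow> norm (\<rho> C) \<le> K" and e: "4 * K * e \<le> 1"
    and A: "A \<in> N" "norm (\<rho> A - mat 1) \<le> e" and B: "B \<in> N"
  defines "Y \<equiv> K * norm ((A - mat 1) ** R)"
  shows "norm (\<rho> (comm A B) - mat 1) \<le> norm (\<rho> B - mat 1) / 2"
    and "norm ((comm A B - mat 1) ** R) \<le> Y * norm (\<rho> B - mat 1) + norm ((B - mat 1) ** R) / 4"
proof -
  define Q where "Q = matrix_inv A ** matrix_inv B"
  have "Q \<in> N" unfolding Q_def by (intro N_mult N_inv A B)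
  then have Q: "norm (\<rho> Q) \<le> K" by (rule K)
  then have K0: "0 \<le> K" by (meson norm_ge_zero order_trans)
  have estimate: "norm ((F ** (\<rho> B - mat 1) - H ** (\<rho> A - mat 1)) ** \<rho> Q)
      \<le> K * norm F * norm (\<rho> B - mat 1) + norm H / 4" for F H :: "complex^2^'k"
  proof -
    have "norm ((F ** (\<rho> B - mat 1) - H ** (\<rho> A - mat 1)) ** \<rho> Q)
        \<le> norm (F ** (\<rho> B - mat 1) - H ** (\<rho> A - mat 1)) * norm (\<rho> Q)"
      by (rule norm_matrix_mult_le)
    also have "\<dots> \<le> (norm F * norm (\<rho> B - mat 1) + norm H * norm (\<rho> A - mat 1)) * K"
      by (intro mult_mono order_trans[OF norm_triangle_ineq4] add_mono norm_matrix_mult_le Q)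
        auto
    also have "\<dots> \<le> (norm F * norm (\<rho> B - mat 1) + norm H * e) * K"
      using A(2) K0 by (intro mult_right_mono add_left_mono mult_left_mono) auto
    also have "\<dots> \<le> K * norm F * norm (\<rho> B - mat 1) + norm H / 4"
      using mult_left_mono[OF e, of "norm H"] by (simp add: algebra_simps)
    finally show ?thesis .
  qed
  show "norm ((comm A B - mat 1) ** R) \<le> Y * norm (\<rho> B - mat 1) + norm ((B - mat 1) ** R) / 4"
    using estimate[of "(A - mat 1) ** R" "(B - mat 1) ** R"]
    unfolding commutator_minus_one[OF A(1) B] Q_def[symmetric] Y_def .
  have "\<rho> (comm A B) - mat 1 = J ** ((comm A B - mat 1) ** R)"
    by (metis rho_diff rho_one \<rho>_def matrix_mul_assoc)
  also have "\<dots> = ((\<rho> A - mat 1) ** (\<rho> B - mat 1) - (\<rho> B - mat 1) ** (\<rho> A - mat 1)) ** \<rho> Q"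
  proof -
    have "J ** ((C - mat 1) ** R) = \<rho> C - mat 1" for C
      by (metis rho_diff rho_one \<rho>_def matrix_mul_assoc)
    then show ?thesis
      unfolding commutator_minus_one[OF A(1) B] Q_def[symmetric]
      by (simp add: bounded_bilinear.diff_right[OF bounded_bilinear_matrix_mult] matrix_mul_assoc)
  qed
  also have "norm \<dots> \<le> K * norm (\<rho> A - mat 1) * norm (\<rho> B - mat 1) + norm (\<rho> B - mat 1) / 4"
    by (rule estimate)
  also have "\<dots> \<le> norm (\<rho> B - mat 1) / 2"
  proof -
    have "K * norm (\<rho> A - mat 1) \<le> 1 / 4"
      using mult_left_mono[OF A(2) K0] e by linarith
    from mult_right_mono[OF this, of "norm (\<rho> B - mat 1)"] show ?thesis by simp
  qed
  finally show "norm (\<rho> (comm A B) - mat 1) \<le> norm (\<rho> B - mat 1) / 2" .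
qed

text \<open>The iterated commutators tend to 1; from the first step on they lie in the discrete group, so one of
them is a scalar fixing the eigenvector.\<close>

lemma iterated_commutator_trivial:
  assumes K: "\<And>C. C \<in> N \<Longrightarrow> norm (\<rho> C) \<le> K" and e: "4 * K * e \<le> 1"
    and A: "A \<in> N" "norm (\<rho> A - mat 1) \<le> e" and B: "B \<in> N"
  shows "\<exists>k. (comm A ^^ k) B = mat 1"
proof -
  define M where "M k = (comm A ^^ k) B" for k
  define x y where "x k = norm (\<rho> (M k) - mat 1)" and "y k = norm ((M k - mat 1) ** R)" for k
  define Y where "Y = K * norm ((A - mat 1) ** R)"
  have M: "M k \<in> N" for k by (induction k) (simp_all add: M_def B commutator_in_N[OF A(1)])
  have "norm (\<rho> A) \<le> K" by (rule K[OF A(1)])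
  then have "0 \<le> K" by (meson norm_ge_zero order_trans)
  then have Y0: "0 \<le> Y" by (simp add: Y_def)
  have step: "x (Suc k) \<le> x k / 2" "y (Suc k) \<le> Y * x k + y k / 4" for k
    using commutator_contracts[OF K e A M[of k]] by (simp_all add: x_def y_def Y_def M_def)
  \<comment> \<open>The weight of \<open>x\<close> is chosen so that the combination contracts although \<open>y\<close> alone need not.\<close>
  define z where "z k = y k + 4 * Y * x k" for k
  have z_step: "z (Suc k) \<le> 3 / 4 * z k" for k
  proof -
    have "0 \<le> y k" by (simp add: y_def)
    then show ?thesis
      using step(2)[of k] mult_left_mono[OF step(1)[of k] Y0] by (simp add: z_def algebra_simps)
  qed
  have z: "z k \<le> (3 / 4) ^ k * z 0" for k
  proof (induction k)
    case (Suc k)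
    then show ?case using z_step[of k] by simp
  qed simp
  have y: "y k \<le> (3 / 4) ^ k * z 0" for k
    using z[of k] Y0 by (simp add: z_def x_def) (smt (verit) mult_nonneg_nonneg norm_ge_zero)
  have z0: "0 \<le> z 0" using Y0 by (simp add: z_def x_def y_def)
  define L where "L = z 0 * norm J + 1"
  have L: "0 < L" using z0 by (simp add: L_def add_nonneg_pos)
  obtain k where k: "(3 / 4 :: real) ^ k < \<delta> / L"
    using real_arch_pow_inv[of "\<delta> / L" "3 / 4"] L delta_pos by auto
  have "norm (M (Suc k) - mat 1) \<le> y (Suc k) * norm J"
  proof -
    have "(M (Suc k) - mat 1) *v v = 0"
      using N_fix[OF M[of "Suc k"]] by (simp add: matrix_vector_mult_diff_rdistrib)
    from factor_through_quotient[OF this] show ?thesis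
      unfolding y_def by (metis norm_matrix_mult_le)
  qed
  also have "\<dots> \<le> (3 / 4) ^ Suc k * z 0 * norm J"
    by (intro mult_right_mono y) simp
  also have "\<dots> \<le> (3 / 4) ^ k * (z 0 * norm J)"
    using z0 by (simp add: mult.assoc mult_left_le_one_le)
  also have "\<dots> \<le> (3 / 4) ^ k * L" by (simp add: L_def)
  also have "\<dots> < \<delta>" using k L by (simp add: field_simps)
  finally obtain c where c: "M (Suc k) = mat c"
    using discrete[of "M (Suc k)"] commutator_in_group[OF A(1) M[of k]] by (auto simp: M_def)
  then have "c *s v = v" using N_fix[OF M[of "Suc k"]] by (simp add: scalar_matrix_vector_mult)
  then have "c = 1" using v_nonzero by (metis vector_mul_rcancel vector_smult_lid)
  then show ?thesis using c unfolding M_def by blast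
qed

text \<open>Descending induction along the iterated commutators, which end at 1: if \<open>\<rho> A\<close> commutes with the image of the commutator
of \<open>A\<close> and \<open>M\<close>, it commutes with a conjugate of itself by \<open>\<rho> M\<close>, hence with \<open>\<rho> M\<close> by Frobenius' lemma, as the trace of \<open>\<rho> M\<close> is close to 2. If \<open>\<rho> A\<close>
has only one eigenvalue, it is a scalar, because its powers are bounded.\<close>

lemma near_identity_commute:
  assumes K: "\<And>C. C \<in> N \<Longrightarrow> norm (\<rho> C) \<le> K" and e: "4 * K * e \<le> 1" "e \<le> 1 / 4"
    and A: "A \<in> N" "norm (\<rho> A - mat 1) \<le> e" and B: "B \<in> N" "norm (\<rho> B - mat 1) \<le> e"
  shows "\<rho> A ** \<rho> B = \<rho> B ** \<rho> A"
proof (cases "(trace (\<rho> A))\<^sup>2 = 4 * det (\<rho> A)")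
  case True
  have "det (transpose (mat (trace (\<rho> A) / 2) - \<rho> A)) = 0"
    unfolding det_transpose char_poly_2 using True by (simp add: power2_eq_square field_simps)
  then have "det (mat (trace (\<rho> A) / 2) - \<rho> A) = 0" by (simp add: det_transpose)
  then obtain u where u: "u \<noteq> 0" "(mat (trace (\<rho> A) / 2) - \<rho> A) *v u = 0"
    using singular_iff_kernel by blast
  have "\<rho> A *v u = (trace (\<rho> A) / 2) *s u"
    using u(2) by (simp add: matrix_vector_mult_diff_rdistrib scalar_matrix_vector_mult)
  then have "cmod (trace (\<rho> A) / 2) = 1" using rho_unimodular[OF A(1) _ u(1)] by blast
  then have "\<rho> A = mat (trace (\<rho> A) / 2)"
  proof (intro bounded_powers_semisimple_2[of "\<rho> ` N"])
    show "bounded (\<rho> ` N)" unfolding bounded_iff using K by blast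
    show "C ** D \<in> \<rho> ` N" if "C \<in> \<rho> ` N" "D \<in> \<rho> ` N" for C D
      using that by (rule rho_image_mult)
  qed (use A True in auto)
  then show ?thesis by (metis mat_commute)
next
  case False
  define M where "M k = (comm A ^^ k) B" for k
  have M: "M k \<in> N" for k by (induction k) (simp_all add: M_def B commutator_in_N[OF A(1)])
  have near: "norm (\<rho> (M k) - mat 1) \<le> 1 / 4" for k
  proof (induction k)
    case 0
    then show ?case using B e by (simp add: M_def)
  next
    case (Suc k)
    have "norm (\<rho> (M (Suc k)) - mat 1) \<le> norm (\<rho> (M k) - mat 1) / 2"
      using commutator_contracts(1)[OF K e(1) A M[of k]] by (simp add: M_def)
    then show ?case using Suc norm_ge_zero[of "\<rho> (M k) - mat 1"] by linarith
  qed
  have tr: "trace (\<rho> (M k)) \<noteq> 0" for k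
  proof
    assume "trace (\<rho> (M k)) = 0"
    then have "trace (\<rho> (M k) - mat 1) = - 2" by (simp add: trace_sub) (simp add: trace_def mat_def)
    then have "2 = cmod ((\<rho> (M k) - mat 1) $ 1 $ 1 + (\<rho> (M k) - mat 1) $ 2 $ 2)"
      by (simp add: trace_def sum_2)
    also have "\<dots> \<le> 1 / 4 + 1 / 4"
      by (intro order_trans[OF norm_triangle_ineq] add_mono order_trans[OF norm_entry_le near])
    finally show False by simp
  qed
  obtain k where k: "M k = mat 1"
    using iterated_commutator_trivial[OF K e(1) A B(1)] unfolding M_def by blast
  have "\<rho> A ** \<rho> (M (k - j)) = \<rho> (M (k - j)) ** \<rho> A" if "j \<le> k" for j
    using that
  proof (induction j)
    case 0
    then show ?case by (simp add: k rho_one)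
  next
    case (Suc j)
    define i where "i = k - Suc j"
    have i: "k - j = Suc i" using Suc.prems by (simp add: i_def)
    have "\<rho> (M (Suc i)) = \<rho> A ** \<rho> (M i) ** \<rho> (matrix_inv A) ** \<rho> (matrix_inv (M i))"
      using A(1) M[of i] N_mult N_inv by (simp add: M_def comm_def rho_N_mult matrix_mul_assoc)
    then have "\<rho> A ** (\<rho> (M i) ** \<rho> A ** \<rho> (matrix_inv (M i)))
        = (\<rho> (M i) ** \<rho> A ** \<rho> (matrix_inv (M i))) ** \<rho> A"
      using Suc unfolding i
      by (intro commutes_with_conjugate_if_commutes_with_commutator[OF rho_inv[OF A(1)] rho_inv[OF M]])
        simp
    then show ?case
      unfolding i_def[symmetric]
      by (rule commutes_if_commutes_with_conjugate_2[OF rho_inv[OF M] False tr])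
  qed
  from this[of k] show ?thesis by (simp add: M_def)
qed

text \<open>A row vector \<open>\<phi>\<close> that witnesses reducibility of the linear parts would be a common left eigenvector of them,
and \<open>\<phi> v* J\<close> a common left eigenvector of \<open>\<Gamma>\<close> killing \<open>v\<close>.\<close>

lemma bounded_rho:
  assumes left: "\<And>f. f \<noteq> 0 \<Longrightarrow> pairing f v = 0 \<Longrightarrow> \<exists>A\<in>\<Gamma>. \<forall>d. f v* A \<noteq> d *s f"
  shows "bounded (\<rho> ` N)"
proof (rule bounded_if_irreducible_bounded_trace)
  show "C ** D \<in> \<rho> ` N" if "C \<in> \<rho> ` N" "D \<in> \<rho> ` N" for C D
    using that by (rule rho_image_mult)
  show "cmod (trace C) \<le> 4" if "C \<in> \<rho> ` N" for C using that cmod_trace_rho_le by auto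
  show "\<exists>X. X \<in> mspan (\<rho> ` N) \<and> X *v y = x" if y: "y \<noteq> 0" for x y
  proof (rule ccontr)
    assume "\<nexists>X. X \<in> mspan (\<rho> ` N) \<and> X *v y = x"
    then obtain \<phi> where \<phi>: "\<phi> \<noteq> 0" "\<And>B. B \<in> N \<Longrightarrow> pairing \<phi> (\<rho> B *v y) = 0"
      using orbit_annihilator by (metis imageI)
    have "\<phi> v* J \<noteq> 0"
      using \<phi>(1) JR by (metis vector_matrix_mul_assoc vector_matrix_mul_rid vector_matrix_mult_0)
    moreover have "pairing (\<phi> v* J) v = 0" by (simp add: pairing_vector_matrix Jv)
    ultimately obtain A where A: "A \<in> \<Gamma>" "\<forall>d. \<phi> v* J v* A \<noteq> d *s (\<phi> v* J)" using left by blast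
    obtain c B where B: "B \<in> N" "A = mat c ** B" using normalise[OF A(1)] by metis
    have "pairing \<phi> y = 0" using \<phi>(2)[OF N_one] by (simp add: rho_one)
    moreover have "pairing (\<phi> v* \<rho> B) y = 0" using \<phi>(2)[OF B(1)] by (simp add: pairing_vector_matrix)
    ultimately obtain d where d: "\<phi> v* \<rho> B = d *s \<phi>"
      using annihilators_proportional_2[OF _ _ \<phi>(1) y] by blast
    have "\<phi> v* J v* A = (c * d) *s (\<phi> v* J)"
      unfolding B(2) vector_matrix_mul_assoc[symmetric]
      unfolding vector_scalar_matrix_mult scalar_vector_matrix_assoc vector_matrix_mul_assoc
        J_intertwine[OF N_eigen[OF B(1)]]
      unfolding vector_matrix_mul_assoc[symmetric] d scalar_vector_matrix_assoc
      by (simp add: vector_smult_assoc)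
    then show False using A(2) by blast
  qed
qed (use traceless_powers_no_fixed_vector_2 in auto)

text \<open>A common left eigenvector \<open>\<phi>\<close> of the linear parts close to 1 gives the row vector \<open>\<phi> v* J\<close> of the flag. Elements with
sufficiently close linear parts differ by an element all of whose conjugates are close to 1.\<close>

lemma reducible_case:
  assumes left: "\<And>f. f \<noteq> 0 \<Longrightarrow> pairing f v = 0 \<Longrightarrow> \<exists>A\<in>\<Gamma>. \<forall>d. f v* A \<noteq> d *s f"
  shows "\<exists>f. f \<noteq> 0 \<and> pairing f v = 0 \<and> virtually_fixes_flag \<Gamma> v f"
proof -
  obtain K where K: "K > 0" "\<And>C. C \<in> N \<Longrightarrow> norm (\<rho> C) \<le> K"
    using bounded_rho[OF left] unfolding bounded_pos by blast
  \<comment> \<open>The first bound makes commutators contract, the second keeps the traces of the linear parts away from 0.\<close>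
  define e where "e = min (1 / (4 * K)) (1 / 4)"
  have e: "0 < e" "4 * K * e \<le> 1" "e \<le> 1 / 4"
    using K(1) by (auto simp: e_def min_def field_simps)
  define Z where "Z = \<rho> ` {B \<in> N. norm (\<rho> B - mat 1) \<le> e}"
  have "U ** W = W ** U" if "U \<in> Z" "W \<in> Z" for U W
    using that near_identity_commute[OF K(2) e(2,3)] unfolding Z_def by blast
  then obtain \<phi> where \<phi>: "\<phi> \<noteq> 0" "\<And>W. W \<in> Z \<Longrightarrow> \<exists>d. \<phi> v* W = d *s \<phi>"
    using commuting_family_common_left_eigenvector_2[of Z] by blast
  define f where "f = \<phi> v* J"
  have f: "f \<noteq> 0"
    using \<phi>(1) JR unfolding f_def
    by (metis vector_matrix_mul_assoc vector_matrix_mul_rid vector_matrix_mult_0)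
  have fv: "pairing f v = 0" by (simp add: f_def pairing_vector_matrix Jv)
  have flag: "fixes_flag v f (mat c ** B)" if B: "B \<in> N" "norm (\<rho> B - mat 1) \<le> e" for B c
  proof -
    obtain d where d: "\<phi> v* \<rho> B = d *s \<phi>" using \<phi>(2) B unfolding Z_def by blast
    have "f v* (mat c ** B) = (c * d) *s f"
      unfolding f_def vector_matrix_mul_assoc[symmetric]
      unfolding vector_scalar_matrix_mult scalar_vector_matrix_assoc vector_matrix_mul_assoc
        J_intertwine[OF N_eigen[OF B(1)]]
      unfolding vector_matrix_mul_assoc[symmetric] d scalar_vector_matrix_assoc
      by (simp add: vector_smult_assoc)
    moreover have "(mat c ** B) *v v = c *s v"
      by (simp add: matrix_vector_mul_assoc[symmetric] scalar_matrix_vector_mult N_fix[OF B(1)])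
    ultimately show ?thesis unfolding fixes_flag_def by blast
  qed
  have "\<exists>c B. cmod c = 1 \<and> B \<in> N \<and> A = mat c ** B" if "A \<in> \<Gamma>" for A
    using normalise[OF that] by metis
  then obtain s n where sn: "\<And>A. A \<in> \<Gamma> \<Longrightarrow> cmod (s A) = 1 \<and> n A \<in> N \<and> A = mat (s A) ** n A"
    by metis
  have s: "s A \<noteq> 0" if "A \<in> \<Gamma>" for A using sn[OF that] by auto
  have "bounded ((\<rho> \<circ> n) ` \<Gamma>)"
    unfolding bounded_iff using K(2) sn by auto
  \<comment> \<open>Three factors bounded by \<open>K\<close> occur below: the inverse of \<open>n B\<close>, and \<open>n C\<close> with its inverse.\<close>
  then obtain T' where T': "finite T'" "T' \<subseteq> (\<rho> \<circ> n) ` \<Gamma>"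
    "\<forall>x\<in>(\<rho> \<circ> n) ` \<Gamma>. \<exists>t\<in>T'. dist t x < e / K ^ 3"
    using bounded_finite_net[of _ "e / K ^ 3"] e(1) K(1)
    by (metis zero_less_divide_iff zero_less_power)
  then obtain T where T: "T \<subseteq> \<Gamma>" "finite T" "T' = (\<rho> \<circ> n) ` T"
    using finite_subset_image[OF T'(1,2)] by blast
  have "\<exists>B\<in>T. \<forall>C\<in>\<Gamma>. fixes_flag v f (C ** (A ** matrix_inv B) ** matrix_inv C)"
    if A: "A \<in> \<Gamma>" for A
  proof -
    obtain B where B: "B \<in> T" "dist (\<rho> (n B)) (\<rho> (n A)) < e / K ^ 3"
      using T'(3) A unfolding T(3) by auto
    have B\<Gamma>: "B \<in> \<Gamma>" using B(1) T(1) by blast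
    have "fixes_flag v f (C ** (A ** matrix_inv B) ** matrix_inv C)" if C: "C \<in> \<Gamma>" for C
    proof -
      note nN = sn[OF A, THEN conjunct2, THEN conjunct1] sn[OF B\<Gamma>, THEN conjunct2, THEN conjunct1]
        sn[OF C, THEN conjunct2, THEN conjunct1]
      define X where "X = n C ** (n A ** matrix_inv (n B)) ** matrix_inv (n C)"
      have X: "X \<in> N" unfolding X_def by (intro N_mult N_inv nN)
      have inv: "matrix_inv D = mat (1 / s D) ** matrix_inv (n D)" if "D \<in> \<Gamma>" for D
        using sn[OF that] matrix_inv_scalar_mult[of "n D" "s D"] s[OF that] by metis
      have "C ** (A ** matrix_inv B) ** matrix_inv C
          = (mat (s C) ** n C) ** ((mat (s A) ** n A) ** (mat (1 / s B) ** matrix_inv (n B)))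
              ** (mat (1 / s C) ** matrix_inv (n C))"
        using inv[OF B\<Gamma>] inv[OF C] sn[OF A] sn[OF C] by metis
      also have "\<dots> = mat (s C * (s A * (1 / s B)) * (1 / s C)) ** X"
        unfolding scaled_mult_scaled X_def ..
      finally have eq: "C ** (A ** matrix_inv B) ** matrix_inv C
          = mat (s C * (s A * (1 / s B)) * (1 / s C)) ** X" .
      have "\<rho> X - mat 1 = \<rho> (n C) ** ((\<rho> (n A) - \<rho> (n B)) ** \<rho> (matrix_inv (n B)))
          ** \<rho> (matrix_inv (n C))"
        unfolding X_def using nN N_mult N_inv
        by (simp add: rho_N_mult bounded_bilinear.diff_left[OF bounded_bilinear_matrix_mult]
            bounded_bilinear.diff_right[OF bounded_bilinear_matrix_mult] rho_inv)
      also have "norm \<dots> \<le> K * (norm (\<rho> (n A) - \<rho> (n B)) * K) * K"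
        using K(1) nN N_inv
        by (intro order_trans[OF norm_matrix_mult_le] mult_mono K(2) mult_nonneg_nonneg) auto
      also have "\<dots> = norm (\<rho> (n A) - \<rho> (n B)) * K ^ 3"
        by (simp add: power3_eq_cube)
      also have "\<dots> \<le> e"
        using B(2) K(1) by (simp add: dist_norm norm_minus_commute field_simps)
      finally show ?thesis unfolding eq using flag X by blast
    qed
    then show ?thesis using B(1) by blast
  qed
  then have "virtually_fixes_flag \<Gamma> v f" unfolding virtually_fixes_flag_def using T by blast
  then show ?thesis using f fv by blast
qed

end

section \<open>Duality and the invariant flag\<close>

lemma matrix_inv_transpose:
  fixes A :: "'a::field^'n^'n"
  assumes "A ** B = mat 1"
  shows "matrix_inv (transpose A) = transpose B"
proof (rule matrix_inv_unique)
  have "B ** A = mat 1" using assms matrix_left_right_inverse by blast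
  then show "transpose A ** transpose B = mat 1" by (simp add: matrix_transpose_mul[symmetric])
qed

lemma norm_transpose: "norm (transpose (A :: complex^'n^'m)) = norm A"
proof -
  have "(\<Sum>i\<in>UNIV. \<Sum>j\<in>UNIV. (cmod (A $ j $ i))\<^sup>2) = (\<Sum>j\<in>UNIV. \<Sum>i\<in>UNIV. (cmod (A $ j $ i))\<^sup>2)"
    by (rule sum.swap)
  then show ?thesis
    by (simp add: norm_vec_def L2_set_def transpose_def sum_nonneg)
qed

lemma matrix_eigenvalue_iff_det: "matrix_eigenvalue A c \<longleftrightarrow> det (mat c - A) = 0"
  unfolding matrix_eigenvalue_def singular_iff_kernel
  by (auto simp: matrix_vector_mult_diff_rdistrib scalar_matrix_vector_mult)

text \<open>Transposition reverses products, so it turns \<open>A ** matrix_inv B\<close> into \<open>matrix_inv B ** A\<close>; these two are conjugate by \<open>B\<close>,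
which is harmless because all conjugates are required to fix the flag.\<close>

lemma virtually_fixes_flag_transpose:
  assumes S: "matrix_group S" and "virtually_fixes_flag (transpose ` S) f v"
  shows "virtually_fixes_flag S v f"
proof -
  obtain T' where "finite T'" "T' \<subseteq> transpose ` S" and T': "\<And>A. A \<in> S \<Longrightarrow> \<exists>B\<in>T'. \<forall>C\<in>S.
      fixes_flag f v (transpose C ** (transpose A ** matrix_inv B) ** matrix_inv (transpose C))"
    using assms(2) unfolding virtually_fixes_flag_def by auto
  then obtain T where T: "T \<subseteq> S" "finite T" "T' = transpose ` T"
    using finite_subset_image by metis
  have "\<exists>B\<in>T. \<forall>D\<in>S. fixes_flag v f (D ** (A ** matrix_inv B) ** matrix_inv D)" if A: "A \<in> S" for A
  proof -
    obtain B where B: "B \<in> T" and flag: "\<And>C. C \<in> S \<Longrightarrow> fixes_flag f v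
        (transpose C ** (transpose A ** matrix_inv (transpose B)) ** matrix_inv (transpose C))"
      using T'[OF A] T(3) by auto
    have BS: "B \<in> S" using B T(1) by blast
    have "fixes_flag v f (D ** (A ** matrix_inv B) ** matrix_inv D)" if D: "D \<in> S" for D
    proof -
      \<comment> \<open>With this choice the inverse of \<open>C\<close> is \<open>D ** B\<close>, which cancels the inverse of \<open>B\<close>.\<close>
      define C where "C = matrix_inv B ** matrix_inv D"
      have C: "C \<in> S" unfolding C_def by (intro matrix_groupD[OF S] BS D)
      have CD: "C ** (D ** B) = mat 1"
        unfolding C_def using matrix_groupD(5)[OF S BS] matrix_groupD(5)[OF S D]
        by (metis matrix_mul_assoc matrix_mul_rid)
      have "transpose C ** (transpose A ** matrix_inv (transpose B)) ** matrix_inv (transpose C)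
          = transpose ((D ** B) ** (matrix_inv B ** A) ** C)"
        unfolding matrix_inv_transpose[OF CD] matrix_inv_transpose[OF matrix_groupD(4)[OF S BS]]
        by (simp add: matrix_transpose_mul matrix_mul_assoc)
      also have "(D ** B) ** (matrix_inv B ** A) ** C = D ** (B ** matrix_inv B) ** A ** C"
        by (simp add: matrix_mul_assoc)
      also have "\<dots> = D ** (A ** matrix_inv B) ** matrix_inv D"
        using matrix_groupD(4)[OF S BS] by (simp add: C_def matrix_mul_assoc)
      finally show ?thesis using flag[OF C] by (simp add: fixes_flag_transpose)
    qed
    then show ?thesis using B by blast
  qed
  then show ?thesis unfolding virtually_fixes_flag_def using T by blast
qed

context discrete_unimodular_group
begin

lemma transpose_group: "discrete_unimodular_group (transpose ` \<Gamma>) \<delta>"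
proof
  show "matrix_group (transpose ` \<Gamma>)"
  proof (rule matrix_groupI)
    show "mat 1 \<in> transpose ` \<Gamma>" using one_in by (metis image_eqI transpose_mat)
    show "C ** D \<in> transpose ` \<Gamma>" if "C \<in> transpose ` \<Gamma>" "D \<in> transpose ` \<Gamma>" for C D
      using that mult_in by (auto simp: matrix_transpose_mul[symmetric])
    show "\<exists>D\<in>transpose ` \<Gamma>. C ** D = mat 1" if "C \<in> transpose ` \<Gamma>" for C
    proof -
      obtain A where A: "A \<in> \<Gamma>" "C = transpose A" using \<open>C \<in> transpose ` \<Gamma>\<close> by blast
      have "C ** transpose (matrix_inv A) = mat 1"
        by (simp add: A matrix_transpose_mul[symmetric] left_inv)
      then show ?thesis using inv_in[OF A(1)] by blast
    qed
  qed
  show "0 < \<delta>" by (rule delta_pos)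
  show "\<exists>c. C = mat c" if C: "C \<in> transpose ` \<Gamma>" "norm (C - mat 1) < \<delta>" for C
  proof -
    obtain A where A: "A \<in> \<Gamma>" "C = transpose A" using C(1) by blast
    have "C - mat 1 = transpose (A - mat 1)"
      unfolding A(2) by (simp add: vec_eq_iff transpose_def mat_def)
    then have "norm (A - mat 1) < \<delta>" using C(2) by (simp add: norm_transpose)
    then show ?thesis using discrete[OF A(1)] A(2) by auto
  qed
  show "cmod c = 1" if C: "C \<in> transpose ` \<Gamma>" "matrix_eigenvalue C c" for C c
  proof -
    obtain A where A: "A \<in> \<Gamma>" "C = transpose A" using C(1) by blast
    have "mat c - C = transpose (mat c - A)"
      unfolding A(2) by (simp add: vec_eq_iff transpose_def mat_def)
    then show ?thesis
      using C(2) unimodular[OF A(1)] by (simp add: matrix_eigenvalue_iff_det)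
  qed
qed

lemma common_eigenvector_case:
  assumes v: "v \<noteq> 0" "\<And>A. A \<in> \<Gamma> \<Longrightarrow> \<exists>c. A *v v = c *s v"
  shows "\<exists>f. f \<noteq> 0 \<and> pairing f v = 0 \<and> virtually_fixes_flag \<Gamma> v f"
proof (cases "\<exists>f. f \<noteq> 0 \<and> pairing f v = 0 \<and> (\<forall>A\<in>\<Gamma>. \<exists>d. f v* A = d *s f)")
  case True
  then obtain f where f: "f \<noteq> 0" "pairing f v = 0" "\<forall>A\<in>\<Gamma>. \<exists>d. f v* A = d *s f" by blast
  have "fixes_flag v f (C ** (A ** matrix_inv (mat 1)) ** matrix_inv C)"
    if "A \<in> \<Gamma>" "C \<in> \<Gamma>" for A C
    unfolding fixes_flag_def using v(2) f(3) that one_in inv_in mult_in by simp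
  then have "virtually_fixes_flag \<Gamma> v f"
    unfolding virtually_fixes_flag_def using one_in by (intro exI[of _ "{mat 1}"]) auto
  then show ?thesis using f by blast
next
  case False
  obtain J :: "complex^3^2" and R :: "complex^2^3" and g where
    JRg: "J ** R = mat 1" "J *v v = 0" "\<And>x. x = R *v (J *v x) + pairing g x *s v"
    using quotient_coordinates[OF v(1)] by metis
  interpret affine_group \<Gamma> \<delta> v J R g
    by unfold_locales (use v JRg in auto)
  show ?thesis using reducible_case False by blast
qed

theorem virtual_flag:
  "\<exists>v f. v \<noteq> 0 \<and> f \<noteq> 0 \<and> pairing f v = 0 \<and> virtually_fixes_flag \<Gamma> v f"
proof -
  consider (right) v where "v \<noteq> 0" "\<And>A. A \<in> \<Gamma> \<Longrightarrow> \<exists>c. A *v v = c *s v"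
    | (left) f where "f \<noteq> 0" "\<And>A. A \<in> \<Gamma> \<Longrightarrow> \<exists>d. f v* A = d *s f"
    | (irreducible) "\<And>v. v \<noteq> 0 \<Longrightarrow> \<exists>A\<in>\<Gamma>. \<forall>c. A *v v \<noteq> c *s v"
      "\<And>f. f \<noteq> 0 \<Longrightarrow> \<exists>A\<in>\<Gamma>. \<forall>d. f v* A \<noteq> d *s f" by metis
  then show ?thesis
  proof cases
    case right
    then show ?thesis using common_eigenvector_case by blast
  next
    case left
    interpret dual: discrete_unimodular_group "transpose ` \<Gamma>" \<delta> by (rule transpose_group)
    obtain v where "v \<noteq> 0" "pairing v f = 0" "virtually_fixes_flag (transpose ` \<Gamma>) f v"
    proof -
      have "\<exists>c. A *v f = c *s f" if "A \<in> transpose ` \<Gamma>" for A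
        using left(2) that by auto
      then show ?thesis using dual.common_eigenvector_case[OF left(1)] that by blast
    qed
    then show ?thesis
      using left(1) virtually_fixes_flag_transpose[OF group] pairing_commute by metis
  next
    case irreducible
    \<comment> \<open>Up to scalars the group is finite, so any flag will do.\<close>
    define v f :: "complex^3" where "v = axis 1 1" and "f = axis 2 1"
    have "v \<noteq> 0" "f \<noteq> 0" "pairing f v = 0"
      by (auto simp: v_def f_def axis_eq_0_iff pairing_axis) (simp add: axis_def)
    then show ?thesis using irreducible_case[OF irreducible] by blast
  qed
qed

end

text \<open>Quotient coordinates \<open>J\<close> for \<open>f\<close>, read as acting on row vectors, parametrise the kernel of \<open>f\<close> by a plane.\<close>

lemma dim_kernel_functional:
  fixes f :: "'a::field^3"
  assumes "f \<noteq> 0"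
  shows "vec.subspace {x. pairing f x = 0}" "vec.dim {x. pairing f x = 0} = 2"
proof -
  show "vec.subspace {x. pairing f x = 0}"
    by (rule vec.subspaceI) (auto simp: pairing_add_right pairing_scale_right)
  obtain J :: "'a^3^2" and R :: "'a^2^3" and g where
    JRg: "J ** R = mat 1" "J *v f = 0" "\<And>x. x = R *v (J *v x) + pairing g x *s f"
    using quotient_coordinates[OF assms] by metis
  have "{x. pairing f x = 0} = range ((*v) (transpose J))"
  proof (intro subset_antisym subsetI)
    fix x assume "x \<in> {x. pairing f x = 0}"
    then have x: "pairing x f = 0" by (simp add: pairing_commute)
    have "pairing x z = pairing (x v* R v* J) z" for z
    proof -
      have "pairing x z = pairing x (R *v (J *v z) + pairing g z *s f)"
        using JRg(3)[of z] by simp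
      also have "\<dots> = pairing x (R *v (J *v z))"
        by (simp add: pairing_add_right pairing_scale_right x)
      finally show ?thesis by (simp add: pairing_vector_matrix)
    qed
    then have "x = x v* R v* J" by (metis pairing_axis vec_eq_iff)
    then show "x \<in> range ((*v) (transpose J))" by (metis rangeI transpose_matrix_vector)
  next
    fix x assume "x \<in> range ((*v) (transpose J))"
    then obtain w where "x = w v* J" by auto
    then show "x \<in> {x. pairing f x = 0}"
      by (simp add: pairing_commute[of f] pairing_vector_matrix JRg(2))
  qed
  moreover have "vec.dim (range ((*v) (transpose J))) = vec.dim (UNIV :: ('a^2) set)"
  proof (rule vec.dim_image_eq)
    show "Vector_Spaces.linear (*s) (*s) ((*v) (transpose J))" by (rule matrix_vector_mul_linear_gen)
    have "x v* J v* R = x" for x by (simp add: vector_matrix_mul_assoc JRg(1))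
    then show "inj_on ((*v) (transpose J)) (vec.span UNIV)"
      by (intro inj_onI) (metis transpose_matrix_vector)
  qed
  moreover have "vec.dim (UNIV :: ('a^2) set) = 2" by (subst vec_dim_card) simp
  ultimately show "vec.dim {x. pairing f x = 0} = 2" by (simp only:)
qed

lemma fixes_flag_mult:
  assumes "fixes_flag v f A" "fixes_flag v f B"
  shows "fixes_flag v f (A ** B)"
proof -
  obtain a b c d where e: "A *v v = a *s v" "B *v v = b *s v" "f v* A = c *s f" "f v* B = d *s f"
    using assms unfolding fixes_flag_def by blast
  have "(A ** B) *v v = (b * a) *s v"
    by (simp add: matrix_vector_mul_assoc[symmetric] e vector_scalar_commute vector_smult_assoc)
  moreover have "f v* (A ** B) = (c * d) *s f"
    by (simp add: vector_matrix_mul_assoc[symmetric] e scalar_vector_matrix_assoc vector_smult_assoc)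
  ultimately show ?thesis unfolding fixes_flag_def by blast
qed

lemma fixes_flag_inverse:
  assumes "fixes_flag v f A" "v \<noteq> 0" "f \<noteq> 0" "A ** B = mat 1"
  shows "fixes_flag v f B"
proof -
  obtain a c where e: "A *v v = a *s v" "f v* A = c *s f"
    using assms(1) unfolding fixes_flag_def by blast
  have BA: "B ** A = mat 1" using assms(4) matrix_left_right_inverse by blast
  have v: "v = a *s (B *v v)"
    using arg_cong[OF e(1), of "(*v) B"] by (simp add: matrix_vector_mul_assoc BA vector_scalar_commute)
  have f: "f = c *s (f v* B)"
    using arg_cong[OF e(2), of "\<lambda>x. x v* B"]
    by (simp add: vector_matrix_mul_assoc assms(4) scalar_vector_matrix_assoc)
  have "a \<noteq> 0" "c \<noteq> 0" using v f assms(2,3) by auto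
  then have "B *v v = (1 / a) *s v" "f v* B = (1 / c) *s f"
    using arg_cong[OF v, of "\<lambda>x. (1 / a) *s x"] arg_cong[OF f, of "\<lambda>x. (1 / c) *s x"]
    by (simp_all add: vector_smult_assoc)
  then show ?thesis unfolding fixes_flag_def by blast
qed

lemma not_less_3: "\<not> (2::3) < 1" "\<not> (1::3) < 0" "\<not> (2::3) < 0"
  by (simp_all add: less_bit1_def bit1.Rep_numeral bit1.Rep_0 bit1.Rep_1)

text \<open>The columns of \<open>P\<close> are \<open>v\<close>, a second vector of the kernel of \<open>f\<close>, and a vector outside of that kernel, in the order
\<open>0 < 1 < 2\<close> of the index type.\<close>

lemma triangularizing_basis:
  fixes v f :: "complex^3"
  assumes v: "v \<noteq> 0" and f: "f \<noteq> 0" and fv: "pairing f v = 0"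
  shows "\<exists>P. invertible P \<and> (\<forall>A. fixes_flag v f A \<longrightarrow> upper_triangular_mat (matrix_inv P ** A ** P))"
proof -
  obtain u where u: "pairing f u = 1" using pairing_nondegenerate[OF f] by blast
  obtain w where w: "pairing f w = 0" "w \<notin> vec.span {v}"
  proof -
    have "\<not> {x. pairing f x = 0} \<subseteq> vec.span {v}"
    proof
      assume "{x. pairing f x = 0} \<subseteq> vec.span {v}"
      then have "vec.dim {x. pairing f x = 0} \<le> card {v}" by (rule vec.dim_le_card) simp
      then show False using dim_kernel_functional(2)[OF f] by simp
    qed
    then show ?thesis using that by blast
  qed
  define P :: "complex^3^3" where "P = (\<chi> i j. if j = 0 then v $ i else if j = 1 then w $ i else u $ i)"
  have three: "(3 :: 3) = 0" by simp
  have Px: "P *v x = x $ 1 *s w + x $ 2 *s u + x $ 0 *s v" for x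
    by (simp add: P_def vec_eq_iff matrix_vector_mult_def sum_3 three mult.commute)
  have "x = 0" if "P *v x = 0" for x
  proof -
    have eq: "x $ 1 *s w + x $ 2 *s u + x $ 0 *s v = 0" using that Px by simp
    have "x $ 2 = 0"
      using arg_cong[OF eq, of "pairing f"] by (simp add: pairing_add_right pairing_scale_right u w fv)
    with eq have eq': "x $ 1 *s w = (- x $ 0) *s v" by (simp add: eq_neg_iff_add_eq_0)
    have "x $ 1 = 0"
    proof (rule ccontr)
      assume "x $ 1 \<noteq> 0"
      then have "w = (- x $ 0 / x $ 1) *s v" (is "_ = ?c *s v")
        using arg_cong[OF eq', of "\<lambda>z. (1 / x $ 1) *s z"] by (simp add: vector_smult_assoc)
      moreover have "?c *s v \<in> vec.span {v}" by (intro vec.span_scale vec.span_base) simp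
      ultimately show False using w(2) by metis
    qed
    with eq' have "x $ 0 = 0" using v by simp
    then show ?thesis
      using \<open>x $ 1 = 0\<close> \<open>x $ 2 = 0\<close> by (simp add: vec_eq_iff forall_3 three)
  qed
  then have inv: "invertible P"
    using invertible_left_inverse matrix_left_invertible_ker by blast
  have "upper_triangular_mat (matrix_inv P ** A ** P)" if A: "fixes_flag v f A" for A
  proof -
    obtain c d where cd: "A *v v = c *s v" "f v* A = d *s f"
      using A unfolding fixes_flag_def by blast
    define Q where "Q = matrix_inv P ** A ** P"
    have Pv: "P *v axis 0 1 = v" unfolding Px by (simp add: axis_def vec_eq_iff)
    have "Q *v axis 0 1 = c *s (matrix_inv P *v v)"
      by (simp add: Q_def matrix_vector_mul_assoc[symmetric] Pv cd vector_scalar_commute)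
    also have "matrix_inv P *v v = axis 0 1"
      by (metis Pv inv matrix_inv_cancel(2) matrix_vector_mul_assoc matrix_vector_mul_lid)
    finally have "Q *v axis 0 1 = c *s axis 0 1" .
    then have col: "Q $ i $ 0 = c * axis 0 1 $ i" for i
      by (simp add: vec_eq_iff matrix_vector_mult_def axis_def if_distrib cong: if_cong)
    have fP: "f v* P = axis 2 1"
    proof -
      have "(f v* P) $ j = pairing f (if j = 0 then v else if j = 1 then w else u)" for j
        by (simp add: P_def vector_matrix_mult_def pairing_def)
      then show ?thesis using fv w(1) u by (simp add: vec_eq_iff forall_3 axis_def)
    qed
    have "axis 2 1 v* Q = f v* (P ** matrix_inv P) v* A v* P"
      unfolding Q_def fP[symmetric] by (simp add: vector_matrix_mul_assoc matrix_mul_assoc)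
    also have "\<dots> = d *s axis 2 1"
      by (simp add: matrix_inv_cancel(1)[OF inv] cd scalar_vector_matrix_assoc fP)
    finally have row: "Q $ 2 $ j = d * axis 2 1 $ j" for j
      by (simp add: vec_eq_iff vector_matrix_mult_def axis_def if_distrib if_distribR cong: if_cong)
    have "Q $ i $ j = 0" if "j < i" for i j
    proof (cases "j = 0")
      case True
      then show ?thesis using col[of i] that by (auto simp: axis_def)
    next
      case False
      then have "i = 2"
        using that exhaust_3[of i] exhaust_3[of j] by (auto simp: three not_less_3)
      then show ?thesis using row[of j] that by (auto simp: axis_def)
    qed
    then show ?thesis unfolding upper_triangular_mat_def Q_def by blast
  qed
  then show ?thesis using inv by blast
qed

section \<open>From matrices to the projective group\<close>

definition (in group) normal_core :: "'a set \<Rightarrow> 'a set" where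
  "normal_core H = {g \<in> carrier G. \<forall>h\<in>carrier G. h \<otimes> g \<otimes> inv h \<in> H}"

lemma (in group) normal_core_normal:
  assumes H: "subgroup H G"
  shows "normal_core H \<lhd> G"
proof -
  have conj_mult: "h \<otimes> (a \<otimes> b) \<otimes> inv h = (h \<otimes> a \<otimes> inv h) \<otimes> (h \<otimes> b \<otimes> inv h)"
    if "a \<in> carrier G" "b \<in> carrier G" "h \<in> carrier G" for a b h
    using that by (simp add: m_assoc inv_solve_left' flip: m_assoc[of "inv h" h])
  have "subgroup (normal_core H) G"
  proof (rule subgroupI)
    show "normal_core H \<subseteq> carrier G" by (auto simp: normal_core_def)
    have "\<one> \<in> normal_core H" using subgroup.one_closed[OF H] by (simp add: normal_core_def)
    then show "normal_core H \<noteq> {}" by blast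
    show "inv a \<in> normal_core H" if "a \<in> normal_core H" for a
    proof -
      have "h \<otimes> inv a \<otimes> inv h \<in> H" if h: "h \<in> carrier G" for h
      proof -
        have "inv (h \<otimes> a \<otimes> inv h) \<in> H"
          using \<open>a \<in> normal_core H\<close> h subgroup.m_inv_closed[OF H] by (simp add: normal_core_def)
        then show ?thesis
          using \<open>a \<in> normal_core H\<close> h by (simp add: normal_core_def inv_mult_group m_assoc)
      qed
      then show ?thesis using that by (simp add: normal_core_def)
    qed
    show "a \<otimes> b \<in> normal_core H" if "a \<in> normal_core H" "b \<in> normal_core H" for a b
      using that subgroup.m_closed[OF H] by (simp add: normal_core_def conj_mult)
  qed
  moreover have "x \<otimes> a \<otimes> inv x \<in> normal_core H" if "x \<in> carrier G" "a \<in> normal_core H" for x a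
  proof -
    have "h \<otimes> (x \<otimes> a \<otimes> inv x) \<otimes> inv h \<in> H" if h: "h \<in> carrier G" for h
    proof -
      have "(h \<otimes> x) \<otimes> a \<otimes> inv (h \<otimes> x) \<in> H"
        using \<open>a \<in> normal_core H\<close> h \<open>x \<in> carrier G\<close> by (simp add: normal_core_def)
      then show ?thesis
        using \<open>a \<in> normal_core H\<close> h \<open>x \<in> carrier G\<close>
        by (simp add: normal_core_def inv_mult_group m_assoc)
    qed
    then show ?thesis using that by (simp add: normal_core_def)
  qed
  ultimately show ?thesis unfolding normal_inv_iff by blast
qed

lemma (in group) finite_rcosets_if_finite_transversal:
  assumes N: "subgroup N G" and T: "finite T" "T \<subseteq> carrier G"
    and "\<And>g. g \<in> carrier G \<Longrightarrow> \<exists>t\<in>T. g \<otimes> inv t \<in> N"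
  shows "finite (rcosets N)"
proof -
  have "N #> g \<in> (\<lambda>t. N #> t) ` T" if g: "g \<in> carrier G" for g
  proof -
    obtain t where t: "t \<in> T" "g \<otimes> inv t \<in> N" using assms(4)[OF g] by blast
    have tG: "t \<in> carrier G" using t(1) T(2) by blast
    have "g = (g \<otimes> inv t) \<otimes> t" using g tG by (simp add: m_assoc)
    then have "g \<in> N #> t" using t(2) unfolding r_coset_def by blast
    then have "N #> t = N #> g" using repr_independence[OF _ tG N] by blast
    then show ?thesis using t(1) by blast
  qed
  then have "rcosets N \<subseteq> (\<lambda>t. N #> t) ` T" unfolding RCOSETS_def by blast
  then show ?thesis using T(1) finite_surj by blast
qed

lemma carrier_SL3: "A \<in> carrier SL3 \<longleftrightarrow> det A = 1"
  by (simp add: SL3_def)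

lemma one_PSL3: "\<one>\<^bsub>PSL3\<^esub> = SL3_scalars"
  by (simp add: PSL3_def FactGroup_def)

lemma mat_one_in_scalars: "mat 1 \<in> SL3_scalars"
  by (auto simp: SL3_scalars_def intro: exI[of _ 1])

lemma PSL3_lift:
  assumes "g \<in> carrier PSL3"
  obtains A where "A \<in> g" "det A = 1"
proof -
  obtain A where A: "det A = 1" "g = SL3_scalars #>\<^bsub>SL3\<^esub> A"
    using assms by (auto simp: PSL3_def carrier_FactGroup carrier_SL3)
  have "mat 1 ** A \<in> g"
    unfolding A(2) r_coset_def using mat_one_in_scalars by (force simp: SL3_def)
  then show ?thesis using that A(1) by simp
qed

lemma PSL3_det: "g \<in> carrier PSL3 \<Longrightarrow> A \<in> g \<Longrightarrow> det A = 1"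
  by (auto simp: PSL3_def carrier_FactGroup carrier_SL3 r_coset_def SL3_scalars_def SL3_def
      det_mul det_mat3)

lemma PSL3_lift_exists:
  assumes "det A = 1"
  shows "\<exists>g\<in>carrier PSL3. A \<in> g"
proof
  show "SL3_scalars #>\<^bsub>SL3\<^esub> A \<in> carrier PSL3"
    using assms by (auto simp: PSL3_def carrier_FactGroup carrier_SL3)
  show "A \<in> SL3_scalars #>\<^bsub>SL3\<^esub> A"
    unfolding r_coset_def using mat_one_in_scalars by (force simp: SL3_def)
qed

lemma PSL3_mult_lift: "A \<in> g \<Longrightarrow> B \<in> h \<Longrightarrow> A ** B \<in> g \<otimes>\<^bsub>PSL3\<^esub> h"
  by (auto simp: PSL3_def FactGroup_def set_mult_def SL3_def)

lemma invertible_if_det_1: "det (A :: complex^3^3) = 1 \<Longrightarrow> invertible A"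
  by (simp add: invertible_det_nz)

text \<open>The class of the inverse matrix is an inverse of the class, since their product meets the unit class and classes are
disjoint.\<close>

lemma PSL3_inv_lift:
  assumes g: "g \<in> carrier PSL3" and A: "A \<in> g"
  shows "matrix_inv A \<in> inv\<^bsub>PSL3\<^esub> g"
proof -
  interpret PSL3: group PSL3 by (rule group_PSL3)
  have inv: "A ** matrix_inv A = mat 1" "matrix_inv A ** A = mat 1"
    using matrix_inv_cancel[OF invertible_if_det_1[OF PSL3_det[OF g A]]] by auto
  then have "det (matrix_inv A) = 1"
    using PSL3_det[OF g A] by (metis det_I det_mul mult.right_neutral)
  then obtain h where h: "h \<in> carrier PSL3" "matrix_inv A \<in> h" using PSL3_lift_exists by blast
  have "h \<otimes>\<^bsub>PSL3\<^esub> g = \<one>\<^bsub>PSL3\<^esub>"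
  proof (rule PSL3_disjoint)
    show "mat 1 \<in> h \<otimes>\<^bsub>PSL3\<^esub> g" using PSL3_mult_lift[OF h(2) A] inv by simp
    show "mat 1 \<in> \<one>\<^bsub>PSL3\<^esub>" by (simp add: one_PSL3 mat_one_in_scalars)
  qed (use g h in auto)
  then have "inv\<^bsub>PSL3\<^esub> g = h" using PSL3.inv_equality g h(1) by blast
  then show ?thesis using h(2) by simp
qed

lemma fixes_flag_all_lifts:
  assumes "g \<in> carrier PSL3" "A \<in> g" "B \<in> g" "fixes_flag v f A"
  shows "fixes_flag v f B"
proof -
  obtain c where "B = mat c ** A" using lift_unique_upto_scalar[OF assms(1-3)] by blast
  then show ?thesis using fixes_flag_mult[OF fixes_flag_scalar assms(4)] by simp
qed

lemma matrix_group_lifts: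
  assumes G: "subgroup G PSL3"
  shows "matrix_group (\<Union>G)"
proof -
  have carrier: "g \<in> carrier PSL3" if "g \<in> G" for g using subgroup.mem_carrier[OF G that] .
  show ?thesis
  proof (rule matrix_groupI)
    show "mat 1 \<in> \<Union>G"
      using subgroup.one_closed[OF G] mat_one_in_scalars by (auto simp: one_PSL3)
    show "A ** B \<in> \<Union>G" if AB: "A \<in> \<Union>G" "B \<in> \<Union>G" for A B
    proof -
      obtain g h where gh: "g \<in> G" "h \<in> G" "A \<in> g" "B \<in> h" using AB by blast
      show ?thesis using subgroup.m_closed[OF G gh(1,2)] PSL3_mult_lift[OF gh(3,4)] by blast
    qed
    show "\<exists>B\<in>\<Union>G. A ** B = mat 1" if "A \<in> \<Union>G" for A
    proof -
      obtain g where g: "g \<in> G" "A \<in> g" using \<open>A \<in> \<Union>G\<close> by blast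
      have "A ** matrix_inv A = mat 1"
        by (rule matrix_inv_cancel invertible_if_det_1 PSL3_det carrier g)+
      moreover have "matrix_inv A \<in> \<Union>G"
        using subgroup.m_inv_closed[OF G g(1)] PSL3_inv_lift[OF carrier[OF g(1)] g(2)] by blast
      ultimately show ?thesis by blast
    qed
  qed
qed

text \<open>The unit class is isolated in \<open>G\<close>, so a neighbourhood of 1 among the matrices meets the lifts of \<open>G\<close> only in scalars.\<close>

lemma discrete_lifts:
  assumes G: "subgroup G PSL3" and "discrete_in_PSL3 G"
  shows "\<exists>\<delta>>0. \<forall>A\<in>\<Union>G. norm (A - mat 1) < \<delta> \<longrightarrow> (\<exists>c. A = mat c)"
proof -
  have one: "\<one>\<^bsub>PSL3\<^esub> \<in> G" by (rule subgroup.one_closed[OF G])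
  have "openin (subtopology PSL3_topology G) {\<one>\<^bsub>PSL3\<^esub>}"
    using assms(2) one unfolding discrete_in_PSL3_def by simp
  then obtain U where U: "openin PSL3_topology U" "{\<one>\<^bsub>PSL3\<^esub>} = U \<inter> G"
    unfolding openin_subtopology by blast
  then have Uc: "U \<subseteq> carrier PSL3" and "openin (top_of_set (carrier SL3)) (\<Union>U)"
    unfolding openin_PSL3_topology SL3_topology_def by blast+
  moreover have "mat 1 \<in> \<Union>U" using U(2) mat_one_in_scalars by (auto simp: one_PSL3)
  ultimately obtain \<delta> where \<delta>: "\<delta> > 0" "\<And>A. A \<in> carrier SL3 \<Longrightarrow> dist A (mat 1) < \<delta> \<Longrightarrow> A \<in> \<Union>U"
    unfolding openin_euclidean_subtopology_iff by blast
  have "\<exists>c. A = mat c" if A: "A \<in> \<Union>G" "norm (A - mat 1) < \<delta>" for A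
  proof -
    obtain g where g: "g \<in> G" "A \<in> g" using A(1) by blast
    have gc: "g \<in> carrier PSL3" using subgroup.mem_carrier[OF G g(1)] .
    obtain h where h: "h \<in> U" "A \<in> h"
      using \<delta>(2)[of A] A(2) PSL3_det[OF gc g(2)] by (auto simp: carrier_SL3 dist_norm)
    have "g = h" using PSL3_disjoint[OF gc _ g(2) h(2)] h(1) Uc by blast
    then have "g = \<one>\<^bsub>PSL3\<^esub>" using U(2) g(1) h(1) by blast
    then show ?thesis using g(2) by (auto simp: one_PSL3 SL3_scalars_def)
  qed
  then show ?thesis using \<delta>(1) by blast
qed

lemma span_singleton_in_P2:
  assumes "v \<noteq> 0"
  shows "vec.span {v} \<in> P2"
proof -
  have "vec.dim {v} = 1" using assms by (subst vec.dim_eq_card_independent) auto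
  then show ?thesis by (simp add: P2_def)
qed

lemma point_image:
  assumes p: "p \<in> P2" and A: "invertible A"
  shows "(*v) A ` p \<in> P2"
proof -
  have lin: "Vector_Spaces.linear (*s) (*s) ((*v) A)" by (rule matrix_vector_mul_linear_gen)
  have "vec.dim ((*v) A ` p) = vec.dim p"
    by (rule vec.dim_image_eq[OF lin]) (meson A inj_matrix_vector_mult inj_on_subset subset_UNIV)
  then show ?thesis using p vec.linear_subspace_image[OF lin] unfolding P2_def by auto
qed

definition flag :: "complex^3 \<Rightarrow> complex^3 \<Rightarrow> point \<times> point set" where
  "flag v f = (vec.span {v}, {p \<in> P2. p \<subseteq> {x. pairing f x = 0}})"

lemma flag_is_full_flag:
  assumes "v \<noteq> 0" "f \<noteq> 0" "pairing f v = 0"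
  shows "flag v f \<in> full_flags"
proof -
  have "vec.span {v} \<in> P2" by (rule span_singleton_in_P2[OF assms(1)])
  moreover have "vec.span {v} \<subseteq> {x. pairing f x = 0}"
    using dim_kernel_functional(1)[OF assms(2)] assms(3) by (intro vec.span_minimal) auto
  ultimately show ?thesis
    using dim_kernel_functional[OF assms(2)] by (auto simp: flag_def full_flags_def complex_lines_def)
qed

lemma flag_invariant:
  assumes vf: "v \<noteq> 0" "f \<noteq> 0"
    and H: "H \<subseteq> carrier PSL3" "\<And>g A. g \<in> H \<Longrightarrow> A \<in> g \<Longrightarrow> fixes_flag v f A"
  shows "leaves_flag_invariant H (flag v f)"
  unfolding leaves_flag_invariant_def
proof (rule ballI)
  fix g assume g: "g \<in> H"
  then have gc: "g \<in> carrier PSL3" using H(1) by blast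
  obtain A where A: "A \<in> g" "det A = 1" using PSL3_lift[OF gc] .
  define B where "B = matrix_inv A"
  have AB: "A ** B = mat 1" "B ** A = mat 1"
    unfolding B_def using matrix_inv_cancel[OF invertible_if_det_1[OF A(2)]] by auto
  have inv: "invertible A" "invertible B" using AB unfolding invertible_def by blast+
  have fixed: "fixes_flag v f A" "fixes_flag v f B"
    using H(2)[OF g A(1)] fixes_flag_inverse[OF _ vf AB(1)] by blast+
  let ?p = "vec.span {v}" and ?W = "{x. pairing f x = 0}"
  have cancel: "(*v) A ` (*v) B ` q = q" for q :: point
    by (simp add: image_image matrix_vector_mul_assoc AB)
  have sub: "(*v) C ` ?p \<subseteq> ?p" "(*v) C ` ?W \<subseteq> ?W" if C: "fixes_flag v f C" for C
  proof -
    obtain c d where cd: "C *v v = c *s v" "f v* C = d *s f"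
      using C unfolding fixes_flag_def by blast
    show "(*v) C ` ?p \<subseteq> ?p"
      by (auto simp: vec.span_singleton vector_scalar_commute cd vector_smult_assoc)
    show "(*v) C ` ?W \<subseteq> ?W"
      by (auto simp: pairing_vector_matrix[symmetric] cd pairing_scale_left)
  qed
  have p: "?p \<in> P2" by (rule span_singleton_in_P2[OF vf(1)])
  have l: "snd (flag v f) = {q \<in> P2. q \<subseteq> ?W}" by (simp add: flag_def)
  have "?p \<subseteq> (*v) A ` ?p"
    using image_mono[OF sub(1)[OF fixed(2)], of "(*v) A"] unfolding cancel .
  then have Ap: "(*v) A ` ?p = ?p" using sub(1)[OF fixed(1)] by (rule subset_antisym[rotated])
  have line: "(*v) C ` q \<in> snd (flag v f)"
    if q: "q \<in> snd (flag v f)" and C: "fixes_flag v f C" "invertible C" for q C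
  proof -
    have "(*v) C ` q \<in> P2" using q l point_image[OF _ C(2)] by simp
    moreover have "(*v) C ` q \<subseteq> ?W"
      using q l sub(2)[OF C(1)] image_mono[of q ?W "(*v) C"] by simp
    ultimately show ?thesis by (simp add: l)
  qed
  have "PSL3_act g ` snd (flag v f) = (\<lambda>q. (*v) A ` q) ` snd (flag v f)"
    by (rule image_cong) (auto simp: l PSL3_act_lift[OF gc A(1)])
  also have "\<dots> = snd (flag v f)"
  proof (intro subset_antisym subsetI)
    show "q \<in> snd (flag v f)" if "q \<in> (\<lambda>q. (*v) A ` q) ` snd (flag v f)" for q
      using that line fixed(1) inv(1) by blast
    show "q \<in> (\<lambda>q. (*v) A ` q) ` snd (flag v f)" if "q \<in> snd (flag v f)" for q
      using line[OF that fixed(2) inv(2)] cancel[of q] by (metis imageI)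
  qed
  finally show "PSL3_act g (fst (flag v f)) = fst (flag v f)
      \<and> PSL3_act g ` snd (flag v f) = snd (flag v f)"
    using PSL3_act_lift[OF gc A(1) p] Ap by (simp add: flag_def)
qed

theorem theorem4p3:
  fixes G :: "(complex^3^3) set set"
  assumes "subgroup G PSL3"
    and "discrete_in_PSL3 G"
    and "\<forall>g\<in>G. \<not> loxodromic g"
  shows "\<exists>G\<^sub>0. G\<^sub>0 \<lhd> (PSL3\<lparr>carrier := G\<rparr>)
           \<and> finite (rcosets\<^bsub>PSL3\<lparr>carrier := G\<rparr>\<^esub> G\<^sub>0)
           \<and> (\<exists>F\<in>full_flags. leaves_flag_invariant G\<^sub>0 F)
           \<and> simultaneously_triangularizable G\<^sub>0"
proof -
  have carrier: "g \<in> carrier PSL3" if "g \<in> G" for g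
    using subgroup.mem_carrier[OF assms(1) that] .
  obtain \<delta> where "\<delta> > 0" "\<And>A. A \<in> \<Union>G \<Longrightarrow> norm (A - mat 1) < \<delta> \<Longrightarrow> \<exists>c. A = mat c"
    using discrete_lifts[OF assms(1,2)] by blast
  then interpret discrete_unimodular_group "\<Union>G" \<delta>
    using matrix_group_lifts[OF assms(1)] assms(3)
    by unfold_locales (auto simp: loxodromic_def)
  obtain v f where vf: "v \<noteq> 0" "f \<noteq> 0" "pairing f v = 0" "virtually_fixes_flag (\<Union>G) v f"
    using virtual_flag by blast
  obtain T where T: "finite T" "T \<subseteq> \<Union>G" "\<And>A. A \<in> \<Union>G \<Longrightarrow> \<exists>B\<in>T. \<forall>C\<in>\<Union>G.
      fixes_flag v f (C ** (A ** matrix_inv B) ** matrix_inv C)"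
    using vf(4) unfolding virtually_fixes_flag_def by metis
  let ?K = "PSL3\<lparr>carrier := G\<rparr>"
  interpret PSL3: group PSL3 by (rule group_PSL3)
  interpret K: group ?K by (rule subgroup.subgroup_is_group[OF assms(1) group_PSL3])
  have invK: "inv\<^bsub>?K\<^esub> g = inv\<^bsub>PSL3\<^esub> g" if "g \<in> G" for g
    by (rule PSL3.m_inv_consistent[OF assms(1) that])
  define H where "H = {g \<in> G. \<forall>A\<in>g. fixes_flag v f A}"
  have HI: "g \<in> H" if "g \<in> G" "A \<in> g" "fixes_flag v f A" for g A
    unfolding H_def using that fixes_flag_all_lifts[OF carrier[OF that(1)] that(2)] by blast
  have "subgroup H ?K"
  proof (rule K.subgroupI)
    show "H \<subseteq> carrier ?K" by (auto simp: H_def)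
    have "\<one>\<^bsub>PSL3\<^esub> \<in> H"
      by (rule HI[OF subgroup.one_closed[OF assms(1)], of "mat 1"])
        (auto simp: one_PSL3 mat_one_in_scalars fixes_flag_scalar)
    then show "H \<noteq> {}" by blast
    show "inv\<^bsub>?K\<^esub> g \<in> H" if g: "g \<in> H" for g
    proof -
      have gG: "g \<in> G" using g by (simp add: H_def)
      obtain A where A: "A \<in> g" "det A = 1" using PSL3_lift[OF carrier[OF gG]] .
      have "fixes_flag v f (matrix_inv A)"
        using g A(1) fixes_flag_inverse[OF _ vf(1,2) matrix_inv_cancel(1)[OF invertible_if_det_1[OF A(2)]]]
        by (simp add: H_def)
      then show ?thesis
        unfolding invK[OF gG]
        by (rule HI[OF subgroup.m_inv_closed[OF assms(1) gG] PSL3_inv_lift[OF carrier[OF gG] A(1)]])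
    qed
    show "g \<otimes>\<^bsub>?K\<^esub> h \<in> H" if gh: "g \<in> H" "h \<in> H" for g h
    proof -
      have G: "g \<in> G" "h \<in> G" using gh by (simp_all add: H_def)
      obtain A B where AB: "A \<in> g" "B \<in> h" using PSL3_lift carrier G by metis
      have "fixes_flag v f (A ** B)" using gh AB by (intro fixes_flag_mult) (auto simp: H_def)
      then show ?thesis
        using HI[OF subgroup.m_closed[OF assms(1) G] PSL3_mult_lift[OF AB]] by simp
    qed
  qed
  then have normal: "K.normal_core H \<lhd> ?K" by (rule K.normal_core_normal)
  define \<pi> where "\<pi> A = (SOME g. g \<in> G \<and> A \<in> g)" for A
  have \<pi>: "\<pi> A \<in> G" "A \<in> \<pi> A" if "A \<in> \<Union>G" for A
    using someI_ex[of "\<lambda>g. g \<in> G \<and> A \<in> g"] that unfolding \<pi>_def by auto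
  have "finite (rcosets\<^bsub>?K\<^esub> K.normal_core H)"
  proof (rule K.finite_rcosets_if_finite_transversal[OF normal_imp_subgroup[OF normal], of "\<pi> ` T"])
    show "finite (\<pi> ` T)" using T(1) by simp
    have "\<pi> B \<in> G" if "B \<in> T" for B using \<pi>(1) T(2) that by blast
    then show "\<pi> ` T \<subseteq> carrier ?K" by auto
    fix g assume "g \<in> carrier ?K"
    then have g: "g \<in> G" by simp
    obtain A where A: "A \<in> g" using PSL3_lift[OF carrier[OF g]] .
    obtain B where B: "B \<in> T" and flag: "\<And>C. C \<in> \<Union>G \<Longrightarrow>
        fixes_flag v f (C ** (A ** matrix_inv B) ** matrix_inv C)"
      using T(3) A g by blast
    have t: "\<pi> B \<in> G" "B \<in> \<pi> B" using \<pi> B T(2) by blast+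
    let ?a = "g \<otimes>\<^bsub>PSL3\<^esub> inv\<^bsub>PSL3\<^esub> \<pi> B"
    have a: "?a \<in> G" "A ** matrix_inv B \<in> ?a"
      using subgroup.m_closed[OF assms(1) g subgroup.m_inv_closed[OF assms(1) t(1)]]
        PSL3_mult_lift[OF A PSL3_inv_lift[OF carrier[OF t(1)] t(2)]] by auto
    have "h \<otimes>\<^bsub>PSL3\<^esub> ?a \<otimes>\<^bsub>PSL3\<^esub> inv\<^bsub>PSL3\<^esub> h \<in> H" if h: "h \<in> G" for h
    proof -
      obtain C where C: "C \<in> h" using PSL3_lift[OF carrier[OF h]] .
      show ?thesis
      proof (rule HI)
        show "h \<otimes>\<^bsub>PSL3\<^esub> ?a \<otimes>\<^bsub>PSL3\<^esub> inv\<^bsub>PSL3\<^esub> h \<in> G"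
          by (rule subgroup.m_closed[OF assms(1) subgroup.m_closed[OF assms(1) h a(1)]
                subgroup.m_inv_closed[OF assms(1) h]])
        show "C ** (A ** matrix_inv B) ** matrix_inv C \<in> h \<otimes>\<^bsub>PSL3\<^esub> ?a \<otimes>\<^bsub>PSL3\<^esub> inv\<^bsub>PSL3\<^esub> h"
          by (intro PSL3_mult_lift PSL3_inv_lift C a(2) carrier[OF h])
        show "fixes_flag v f (C ** (A ** matrix_inv B) ** matrix_inv C)"
          using flag C h by blast
      qed
    qed
    then have "?a \<in> K.normal_core H"
      unfolding K.normal_core_def using a(1) invK by simp
    then show "\<exists>t\<in>\<pi> ` T. g \<otimes>\<^bsub>?K\<^esub> inv\<^bsub>?K\<^esub> t \<in> K.normal_core H"
      using B by (intro bexI[of _ "\<pi> B"]) (simp_all add: invK[OF t(1)])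
  qed
  moreover have core: "g \<in> H" if "g \<in> K.normal_core H" for g
  proof -
    have "g \<in> carrier ?K" "\<one>\<^bsub>?K\<^esub> \<otimes>\<^bsub>?K\<^esub> g \<otimes>\<^bsub>?K\<^esub> inv\<^bsub>?K\<^esub> \<one>\<^bsub>?K\<^esub> \<in> H"
      using that K.one_closed unfolding K.normal_core_def by blast+
    then show ?thesis using K.inv_one K.l_one K.r_one by metis
  qed
  then have core_flag: "fixes_flag v f A" if "g \<in> K.normal_core H" "A \<in> g" for g A
    using that unfolding H_def by blast
  have "leaves_flag_invariant (K.normal_core H) (flag v f)"
  proof (rule flag_invariant[OF vf(1,2)])
    show "K.normal_core H \<subseteq> carrier PSL3" using core carrier unfolding H_def by blast
  qed (rule core_flag)
  moreover have "simultaneously_triangularizable (K.normal_core H)"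
    unfolding simultaneously_triangularizable_def
    using triangularizing_basis[OF vf(1-3)] core_flag by metis
  ultimately show ?thesis using normal flag_is_full_flag[OF vf(1-3)] by blast
qed

end
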